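(* Let $(E,d)$ be a Polish metric space, let $C>0$, let $\mu\in\mathcal P(E)$ satisfy a $\mathbf T_1(C)$ inequality, and let $L_n=\frac1n\sum_{i=1}^n\delta_{X_i}$ where $X_1,\dots,X_n$ are i.i.d. with law $\mu$. Then for every $t>0$, $$\mathbb P\big(W_1(\mu,L_n)\ge t\big)\le K_t\,e^{-nt^2/(8C)},$$ where $$K_t=\exp\left[\frac1C\,\inf_\nu\ \mathrm{Card}(\mathrm{Supp}\,\nu)\,\big(\mathrm{Diam}\,\mathrm{Supp}\,\nu\big)^2\right]$$ and $\nu$ runs over all probability measures on $E$ with finite support such that $W_1(\mu,\nu)\le t/4$.
   Context: $\mathcal P(E)$ is the set of Borel probability measures on $E$ and $\mathcal P_1(E)$ those with finite first moment. $W_1(\mu,\nu)=\inf_\pi\int d(x,y)\,\pi(dx,dy)$ over couplings $\pi$ of $\mu,\nu$. The relative entropy is $H(\nu|\mu)=\int\log\frac{d\nu}{d\mu}\,d\nu$ if $\nu\ll\mu$ and $+\infty$ otherwise. $\mu\in\mathcal P_1(E)$ satisfies $\mathbf T_1(C)$ if $W_1(\mu,\nu)\le\sqrt{C\,H(\nu|\mu)}$ for all $\nu\in\mathcal P_1(E)$. *)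

theory Defs
  imports "HOL-Probability.Probability"
begin

definition prob_measures :: "'a::polish_space measure set" where
  "prob_measures = {\<mu>. prob_space \<mu> \<and> sets \<mu> = sets borel}"

definition prob_measures1 :: "'a::polish_space measure set" where
  "prob_measures1 = {\<mu> \<in> prob_measures. \<exists>x\<^sub>0. integrable \<mu> (\<lambda>x. dist x\<^sub>0 x)}"

text \<open>The product of the two Borel sigma-algebras is the Borel sigma-algebra of the product,
  because the space is second countable.\<close>

definition couplings :: "'a::polish_space measure \<Rightarrow> 'a measure \<Rightarrow> ('a \<times> 'a) measure set" where
  "couplings \<mu> \<nu> = {\<pi>. prob_space \<pi> \<and> sets \<pi> = sets (borel \<Otimes>\<^sub>M borel) \<and>
     distr \<pi> borel fst = \<mu> \<and> distr \<pi> borel snd = \<nu>}"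

definition W1 :: "'a::polish_space measure \<Rightarrow> 'a measure \<Rightarrow> ennreal" where
  "W1 \<mu> \<nu> = (INF \<pi>\<in>couplings \<mu> \<nu>. \<integral>\<^sup>+ z. ennreal (dist (fst z) (snd z)) \<partial>\<pi>)"

text \<open>\<open>KL_divergence b \<mu> \<nu>\<close> is the Bochner integral of \<open>log b (d\<nu>/d\<mu>)\<close> with respect to \<open>\<nu>\<close>, which is
  0 if the integrand is not integrable. The negative part of \<open>ln (d\<nu>/d\<mu>)\<close> is always
  \<open>\<nu>\<close>-integrable for probability measures (\<open>u * ln u \<ge> -1/e\<close>), so that in the non-integrable case
  the integral is \<open>\<infinity>\<close>.\<close>

definition rel_entropy :: "'a::polish_space measure \<Rightarrow> 'a measure \<Rightarrow> ereal" where
  "rel_entropy \<nu> \<mu> =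
     (if absolutely_continuous \<mu> \<nu> \<and> integrable \<nu> (entropy_density (exp 1) \<mu> \<nu>)
      then ereal (KL_divergence (exp 1) \<mu> \<nu>) else \<infinity>)"

text \<open>The square root on \<open>[0, \<infinity>]\<close>.\<close>

definition esqrt :: "ereal \<Rightarrow> ereal" where
  "esqrt x = (if x = \<infinity> then \<infinity> else ereal (sqrt (real_of_ereal x)))"

definition T1 :: "real \<Rightarrow> 'a::polish_space measure \<Rightarrow> bool" where
  "T1 C \<mu> \<longleftrightarrow> \<mu> \<in> prob_measures1 \<and>
     (\<forall>\<nu>\<in>prob_measures1. enn2ereal (W1 \<mu> \<nu>) \<le> esqrt (ereal C * rel_entropy \<nu> \<mu>))"

definition empirical_measure :: "nat \<Rightarrow> (nat \<Rightarrow> 'a::polish_space) \<Rightarrow> 'a measure" where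
  "empirical_measure n x =
     measure_of UNIV (sets borel) (\<lambda>A. (\<Sum>i = 1..n. emeasure (return borel (x i)) A) / of_nat n)"

definition Supp :: "'a::polish_space measure \<Rightarrow> 'a set" where
  "Supp \<nu> = {x. \<forall>U. open U \<and> x \<in> U \<longrightarrow> emeasure \<nu> U > 0}"

text \<open>The infimum is over a set of nonnegative reals, which is nonempty for every \<open>\<mu>\<close> with finite
  first moment and every \<open>t > 0\<close>: finitely supported measures are \<open>W1\<close>-dense among those.\<close>

definition K_const :: "real \<Rightarrow> 'a::polish_space measure \<Rightarrow> real \<Rightarrow> real" where
  "K_const C \<mu> t =
     exp (1 / C * (INF \<nu>\<in>{\<nu> \<in> prob_measures. finite (Supp \<nu>) \<and> W1 \<mu> \<nu> \<le> ennreal (t / 4)}.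
                      real (card (Supp \<nu>)) * (diameter (Supp \<nu>))\<^sup>2))"

lemma sets_empirical_measure [simp]: "sets (empirical_measure n x) = sets borel"
  unfolding empirical_measure_def
  by (metis sets.sigma_sets_eq sets_measure_of sets.space_closed space_borel)

lemma emeasure_empirical_measure:
  assumes "A \<in> sets borel"
  shows "emeasure (empirical_measure n x) A = (\<Sum>i = 1..n. indicator A (x i)) / of_nat n"
proof -
  have "emeasure (empirical_measure n x) A
      = (\<Sum>i = 1..n. emeasure (return borel (x i)) A) / of_nat n"
    unfolding empirical_measure_def
  proof (rule emeasure_measure_of_sigma)
    show "sigma_algebra UNIV (sets (borel :: 'a measure))"
      using sets.sigma_algebra_axioms[of borel] by simp
    show "positive (sets borel) (\<lambda>A. (\<Sum>i = 1..n. emeasure (return borel (x i)) A) / of_nat n)"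
      by (simp add: positive_def)
    show "countably_additive (sets borel)
            (\<lambda>A. (\<Sum>i = 1..n. emeasure (return borel (x i)) A) / of_nat n)"
    proof (rule countably_additiveI)
      fix B :: "nat \<Rightarrow> 'a set"
      assume B: "range B \<subseteq> sets borel" "disjoint_family B" "\<Union> (range B) \<in> sets borel"
      have "(\<Sum>k. (\<Sum>i = 1..n. emeasure (return borel (x i)) (B k)) / of_nat n)
          = (\<Sum>k. \<Sum>i = 1..n. emeasure (return borel (x i)) (B k)) / of_nat n"
        by (simp add: divide_ennreal_def)
      also have "\<dots> = (\<Sum>i = 1..n. \<Sum>k. emeasure (return borel (x i)) (B k)) / of_nat n"
        by (subst suminf_sum) auto
      also have "\<dots> = (\<Sum>i = 1..n. emeasure (return borel (x i)) (\<Union> (range B))) / of_nat n"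
        using B by (subst suminf_emeasure) auto
      finally show "(\<Sum>k. (\<Sum>i = 1..n. emeasure (return borel (x i)) (B k)) / of_nat n)
          = (\<Sum>i = 1..n. emeasure (return borel (x i)) (\<Union> (range B))) / of_nat n" .
    qed
  qed (use assms in auto)
  with assms show ?thesis by simp
qed

end

theory Submission
  imports Defs
begin

text \<open>Couplings of \<open>\<mu>\<close> with \<open>L\<^sub>n\<close> are described by weights \<open>w\<^sub>i\<close> (the part of the mass at \<open>y\<close> that is sent to
  \<open>X\<^sub>i\<close>), and the optimal cost over all weights, as a function of the sample points, dominates
  \<open>W\<^sub>1(\<mu>, L\<^sub>n)\<close> and is \<open>1/n\<close>-Lipschitz in every coordinate because every \<open>w\<^sub>i\<close> has mass \<open>1/n\<close>.
  Transport-entropy duality (Bobkov--Goetze) and tensorization then give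
  Gaussian concentration \<open>exp (- n s\<^sup>2 / C)\<close> around its mean. If \<open>\<nu>\<close> has \<open>m\<close> atoms and a support of diameter
  \<open>D\<close>, and \<open>W\<^sub>1(\<mu>, \<nu>) \<le> t/4\<close>, discretizing both \<open>\<mu>\<close> and the sample along a near-optimal coupling of \<open>\<mu>\<close> and \<open>\<nu>\<close>
  bounds this mean by \<open>t/2 + a\<close>, where \<open>a = D sqrt (m/n)\<close>. With \<open>s \<ge> t/2 - a\<close> one has \<open>s\<^sup>2 \<ge> t\<^sup>2/8 - a\<^sup>2\<close>, and
  \<open>n a\<^sup>2 / C = m D\<^sup>2 / C\<close> is the exponent of the constant.\<close>

section \<open>Exponential moments of Lipschitz functions\<close>

text \<open>The couplings in \<open>W1\<close> change with the sample, whereas the set of admissible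
  weights does not depend on it. The optimal weight cost is therefore an infimum of functions with a
  common Lipschitz constant, and Lipschitz continuity also yields measurability. Cutting it off at
  \<open>t\<close> makes it bounded without changing the event that it reaches \<open>t\<close>. The
  rate: transport-entropy duality bounds the centred log-Laplace transform of an
  \<open>L\<close>-Lipschitz function by \<open>L\<^sup>2 * C / 4\<close>; for \<open>n\<close>
  coordinates with \<open>L = l / n\<close> this is \<open>l\<^sup>2 * C / (4 * n)\<close>, whose
  Legendre dual is \<open>n * s\<^sup>2 / C\<close>. The mean: a coupling of \<open>\<mu>\<close>
  and \<open>\<nu>\<close> sends \<open>y\<close> to atom \<open>k\<close> only with some
  probability \<open>u k y\<close>. The same \<open>u\<close> is applied to \<open>\<mu>\<close> and
  to the sample points, whose law is \<open>\<mu>\<close>, so the cost of about \<open>t / 4\<close>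
  is paid twice. In between, \<open>\<nu> {k}\<close> and the average of \<open>u k (X i)\<close>
  differ by at most \<open>sqrt (\<nu> {k} / n)\<close> in mean, each unit of difference costs at
  most \<open>D\<close>, and Cauchy-Schwarz over the \<open>m\<close> atoms sums these terms to
  \<open>sqrt (m / n)\<close>.\<close>

text \<open>The easy half of Kantorovich duality: against a coupling, both integrals become
  integrals over one measure and the Lipschitz bound applies pointwise. Boundedness of
  \<open>f\<close> supplies integrability.\<close>

lemma W1_ge_integral_diff:
  fixes f :: "'a::polish_space \<Rightarrow> real"
  assumes "\<mu> \<in> prob_measures" "\<nu> \<in> prob_measures"
    and f: "f \<in> borel_measurable borel" and B: "\<And>x. \<bar>f x\<bar> \<le> B"
    and "L \<ge> 0" and L: "\<And>x y. \<bar>f x - f y\<bar> \<le> L * dist x y"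
  shows "ennreal ((\<integral>x. f x \<partial>\<nu>) - (\<integral>x. f x \<partial>\<mu>)) \<le> ennreal L * W1 \<mu> \<nu>"
proof -
  have step: "ennreal ((\<integral>x. f x \<partial>\<nu>) - (\<integral>x. f x \<partial>\<mu>)) \<le>
      ennreal L * (\<integral>\<^sup>+ z. ennreal (dist (fst z) (snd z)) \<partial>\<pi>)" if "\<pi> \<in> couplings \<mu> \<nu>" for \<pi>
  proof -
    from that have s: "sets \<pi> = sets (borel \<Otimes>\<^sub>M borel)" and "prob_space \<pi>"
      and d: "distr \<pi> borel fst = \<mu>" "distr \<pi> borel snd = \<nu>"
      by (auto simp: couplings_def)
    interpret prob_space \<pi> by fact
    note s[measurable_cong] f[measurable]
    have i1: "integrable \<pi> (\<lambda>z. f (fst z))" and i2: "integrable \<pi> (\<lambda>z. f (snd z))"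
      by (rule integrable_const_bound[where B=B]; use B in auto)+
    have "(\<integral>x. f x \<partial>\<nu>) - (\<integral>x. f x \<partial>\<mu>) = (\<integral>z. f (snd z) - f (fst z) \<partial>\<pi>)"
      unfolding d[symmetric] using i1 i2 by (simp add: integral_distr)
    also have "ennreal \<dots> \<le> (\<integral>\<^sup>+ z. ennreal \<bar>f (snd z) - f (fst z)\<bar> \<partial>\<pi>)"
    proof -
      have "ennreal (\<integral>z. f (snd z) - f (fst z) \<partial>\<pi>) \<le> ennreal (\<integral>z. \<bar>f (snd z) - f (fst z)\<bar> \<partial>\<pi>)"
        by (intro ennreal_leI integral_mono) (use i1 i2 in auto)
      also have "\<dots> = (\<integral>\<^sup>+ z. ennreal \<bar>f (snd z) - f (fst z)\<bar> \<partial>\<pi>)"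
        by (rule nn_integral_eq_integral[symmetric]) (use i1 i2 in auto)
      finally show ?thesis .
    qed
    also have "\<dots> \<le> (\<integral>\<^sup>+ z. ennreal L * ennreal (dist (fst z) (snd z)) \<partial>\<pi>)"
    proof (rule nn_integral_mono)
      show "ennreal \<bar>f (snd z) - f (fst z)\<bar> \<le> ennreal L * ennreal (dist (fst z) (snd z))" for z
        using L[of "snd z" "fst z"] \<open>L \<ge> 0\<close>
        by (simp add: ennreal_mult[symmetric] dist_commute ennreal_leI)
    qed
    also have "\<dots> = ennreal L * (\<integral>\<^sup>+ z. ennreal (dist (fst z) (snd z)) \<partial>\<pi>)"
      by (rule nn_integral_cmult) measurable
    finally show ?thesis .
  qed
  \<comment> \<open>The infimum is reached after dividing by \<open>L\<close>, so
    \<open>L = 0\<close> is treated apart; there \<open>f\<close> is constant and both integrals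
    agree.\<close>
  show ?thesis
  proof (cases "L = 0")
    case True
    have "f x = f undefined" for x using L[of x undefined] True by simp
    then have "(\<integral>x. f x \<partial>\<nu>) = f undefined" "(\<integral>x. f x \<partial>\<mu>) = f undefined"
      using assms(1,2) by (metis (mono_tags, lifting) Bochner_Integration.integral_cong
        mem_Collect_eq prob_measures_def prob_space.prob_space lebesgue_integral_const scaleR_one)+
    then show ?thesis using True by simp
  next
    case False
    with \<open>L \<ge> 0\<close> have [simp]: "L > 0" by simp
    have "ennreal (((\<integral>x. f x \<partial>\<nu>) - (\<integral>x. f x \<partial>\<mu>)) / L) \<le> W1 \<mu> \<nu>"
      unfolding W1_def
    proof (rule INF_greatest)
      fix \<pi> assume "\<pi> \<in> couplings \<mu> \<nu>"
      from step[OF this] show "ennreal (((\<integral>x. f x \<partial>\<nu>) - (\<integral>x. f x \<partial>\<mu>)) / L) \<le>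
          (\<integral>\<^sup>+ z. ennreal (dist (fst z) (snd z)) \<partial>\<pi>)"
      proof (cases "(\<integral>\<^sup>+ z. ennreal (dist (fst z) (snd z)) \<partial>\<pi>)")
        case (real r)
        with step[OF \<open>\<pi> \<in> couplings \<mu> \<nu>\<close>] have "((\<integral>x. f x \<partial>\<nu>) - (\<integral>x. f x \<partial>\<mu>)) \<le> L * r"
          using real(2) \<open>L \<ge> 0\<close> by (simp flip: ennreal_mult)
        then have "((\<integral>x. f x \<partial>\<nu>) - (\<integral>x. f x \<partial>\<mu>)) / L \<le> r" by (simp add: field_simps)
        then show ?thesis using real by (simp add: ennreal_leI)
      qed auto
    qed
    then have "ennreal L * ennreal (((\<integral>x. f x \<partial>\<nu>) - (\<integral>x. f x \<partial>\<mu>)) / L) \<le> ennreal L * W1 \<mu> \<nu>"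
      by (rule mult_left_mono) simp
    moreover have "ennreal ((\<integral>x. f x \<partial>\<nu>) - (\<integral>x. f x \<partial>\<mu>)) =
        ennreal L * ennreal (((\<integral>x. f x \<partial>\<nu>) - (\<integral>x. f x \<partial>\<mu>)) / L)"
      using \<open>L \<ge> 0\<close> False by (simp flip: ennreal_mult')
    ultimately show ?thesis by simp
  qed
qed

text \<open>The transport-entropy inequality is applied to the measure with density \<open>exp f / Z\<close>.\<close>

lemma T1_imp_exponential_moment:
  fixes f :: "'a::polish_space \<Rightarrow> real"
  assumes "C > 0" and T1: "T1 C \<mu>"
    and f: "f \<in> borel_measurable borel" and B: "\<And>x. \<bar>f x\<bar> \<le> B"
    and "L \<ge> 0" and L: "\<And>x y. \<bar>f x - f y\<bar> \<le> L * dist x y"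
  shows "(\<integral>x. exp (f x) \<partial>\<mu>) \<le> exp ((\<integral>x. f x \<partial>\<mu>) + L\<^sup>2 * C / 4)"
proof -
  from T1 have mu: "\<mu> \<in> prob_measures" and s[measurable_cong]: "sets \<mu> = sets borel" and "prob_space \<mu>"
    by (auto simp: T1_def prob_measures1_def prob_measures_def)
  from T1 obtain x0 where x0: "integrable \<mu> (\<lambda>x. dist x0 x)"
    by (auto simp: T1_def prob_measures1_def)
  interpret prob_space \<mu> by fact
  note f[measurable]
  define Z where "Z = (\<integral>x. exp (f x) \<partial>\<mu>)"
  have int_exp: "integrable \<mu> (\<lambda>x. exp (f x))"
    by (rule integrable_const_bound[where B="exp B"]) (use B abs_le_D1 in auto)
  have "exp (-B) = (\<integral>x. exp (-B) \<partial>\<mu>)" by (simp add: prob_space)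
  also have "\<dots> \<le> Z" unfolding Z_def
    by (rule integral_mono) (use int_exp B in \<open>auto simp: abs_le_iff minus_le_iff\<close>)
  finally have Z: "Z > 0" by (meson exp_gt_zero less_le_trans)
  define g where "g x = exp (f x) / Z" for x
  have g[measurable]: "g \<in> borel_measurable borel" and g0: "g x > 0" for x
    unfolding g_def using Z by auto
  have gB: "g x \<le> exp B / Z" for x
    using B[of x] Z by (auto simp: g_def intro!: divide_right_mono)
  have int_g: "integrable \<mu> g" "(\<integral>x. g x \<partial>\<mu>) = 1"
    unfolding g_def using int_exp Z by (auto simp: Z_def)
  define \<nu> where "\<nu> = density \<mu> g"
  have nu_s[measurable_cong]: "sets \<nu> = sets borel" by (simp add: \<nu>_def s)
  have "emeasure \<nu> (space \<nu>) = 1"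
    using int_g g0 by (simp add: \<nu>_def emeasure_density nn_integral_eq_integral less_imp_le cong: nn_integral_cong)
  then have "prob_space \<nu>" by (rule prob_spaceI)
  then interpret nu: prob_space \<nu> .
  have nu: "\<nu> \<in> prob_measures" using \<open>prob_space \<nu>\<close> nu_s by (simp add: prob_measures_def)
  \<comment> \<open>\<open>T1\<close> speaks only of measures with finite first moment. The density
    \<open>g\<close> is bounded by \<open>exp B / Z\<close>, so \<open>\<nu>\<close> inherits this
    from \<open>\<mu>\<close>.\<close>
  have "integrable \<nu> (\<lambda>x. dist x0 x)"
    unfolding \<nu>_def
  proof (subst integrable_real_density)
    show "integrable \<mu> (\<lambda>x. g x * dist x0 x)"
      by (rule Bochner_Integration.integrable_bound[where f="\<lambda>x. (exp B / Z) * dist x0 x"])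
         (use x0 g0 gB Z in \<open>auto simp: abs_mult less_imp_le simp flip: times_divide_eq_left intro!: mult_right_mono\<close>)
  qed (use g0 in \<open>auto simp: less_imp_le\<close>)
  with nu have nu1: "\<nu> \<in> prob_measures1" by (auto simp: prob_measures1_def)
  have lng: "log (exp 1) (g x) = f x - ln Z" for x
    using Z by (simp add: g_def log_def ln_div)
  have int_f: "integrable \<nu> f"
    by (rule nu.integrable_const_bound[where B=B]) (use B in auto)
  have KL: "KL_divergence (exp 1) \<mu> \<nu> = (\<integral>x. f x \<partial>\<nu>) - ln Z"
  proof -
    have "KL_divergence (exp 1) \<mu> \<nu> = (\<integral>x. g x * log (exp 1) (g x) \<partial>\<mu>)"
      unfolding \<nu>_def by (rule KL_density) (use g0 in \<open>auto simp: less_imp_le\<close>)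
    also have "\<dots> = (\<integral>x. f x - ln Z \<partial>\<nu>)"
      unfolding \<nu>_def by (subst integral_real_density) (use g0 in \<open>auto simp: less_imp_le lng\<close>)
    also have "\<dots> = (\<integral>x. f x \<partial>\<nu>) - ln Z"
      using int_f by (simp add: nu.prob_space)
    finally show ?thesis .
  qed
  have ac: "absolutely_continuous \<mu> \<nu>"
    unfolding \<nu>_def by (rule absolutely_continuousI_density) measurable
  \<comment> \<open>\<open>rel_entropy\<close> tests integrability of a function built from
    \<open>RN_deriv\<close>, which is determined only almost everywhere. Identifying it with
    \<open>f - ln Z\<close> puts \<open>rel_entropy\<close> into its finite branch.\<close>
  have "AE x in \<mu>. ennreal (g x) = RN_deriv \<mu> \<nu> x"
    by (rule RN_deriv_unique) (auto simp: \<nu>_def)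
  then have "AE x in \<mu>. entropy_density (exp 1) \<mu> \<nu> x = f x - ln Z"
    by eventually_elim (metis (no_types, lifting) comp_apply enn2real_ennreal entropy_density_def g0 less_imp_le lng)
  then have AEnu: "AE x in \<nu>. entropy_density (exp 1) \<mu> \<nu> x = f x - ln Z"
    using ac absolutely_continuous_AE[of \<nu> \<mu>] nu_s s by auto
  have "integrable \<nu> (entropy_density (exp 1) \<mu> \<nu>)"
  proof (subst integrable_cong_AE[OF _ _ AEnu])
    show "integrable \<nu> (\<lambda>x. f x - ln Z)"
      using int_f by simp
    show "entropy_density (exp 1) \<mu> \<nu> \<in> borel_measurable \<nu>"
      using measurable_entropy_density[of "exp 1" \<mu> \<nu>] nu_s s measurable_cong_sets by blast
  qed auto
  with ac have H: "rel_entropy \<nu> \<mu> = ereal ((\<integral>x. f x \<partial>\<nu>) - ln Z)"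
    by (simp add: rel_entropy_def KL)
  define h where "h = (\<integral>x. f x \<partial>\<nu>) - ln Z"
  from T1 nu1 have le: "enn2ereal (W1 \<mu> \<nu>) \<le> ereal (sqrt (C * h))"
    by (auto simp: T1_def H esqrt_def h_def)
  then have W: "W1 \<mu> \<nu> \<le> ennreal (sqrt (C * h))"
    by (metis e2ennreal_enn2ereal e2ennreal_mono ennreal.abs_eq e2ennreal_ereal)
  \<comment> \<open>The real \<open>sqrt\<close> is negative at negative arguments, so the bound on
    the nonnegative \<open>W1\<close> already forces \<open>h\<close> to be nonnegative, without
    Jensen's inequality.\<close>
  have sq0: "0 \<le> sqrt (C * h)"
    using le by (metis ereal_less_eq(5) enn2ereal_nonneg order_trans)
  then have h0: "0 \<le> h" using \<open>C > 0\<close> by (simp add: zero_le_mult_iff)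
  have "ennreal ((\<integral>x. f x \<partial>\<nu>) - (\<integral>x. f x \<partial>\<mu>)) \<le> ennreal L * W1 \<mu> \<nu>"
    by (rule W1_ge_integral_diff[OF mu nu f B \<open>L \<ge> 0\<close> L])
  also have "\<dots> \<le> ennreal L * ennreal (sqrt (C * h))"
    by (rule mult_left_mono[OF W]) simp
  finally have "(\<integral>x. f x \<partial>\<nu>) - (\<integral>x. f x \<partial>\<mu>) \<le> L * sqrt (C * h)"
    using \<open>L \<ge> 0\<close> sq0 by (simp add: ennreal_mult[symmetric])
  \<comment> \<open>Completing the square in \<open>sqrt h\<close> produces the constant
    \<open>L\<^sup>2 * C / 4\<close>. As \<open>h\<close> is the mean of \<open>f\<close> under
    \<open>\<nu>\<close> minus \<open>ln Z\<close>, the \<open>\<nu>\<close>-mean then cancels and a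
    bound on \<open>ln Z\<close> is left.\<close>
  moreover have "L * sqrt (C * h) \<le> h + L\<^sup>2 * C / 4"
  proof -
    have "0 \<le> (sqrt h - L * sqrt C / 2)\<^sup>2" by simp
    also have "\<dots> = h + L\<^sup>2 * C / 4 - L * sqrt (C * h)"
      using \<open>C > 0\<close> h0 by (simp add: power2_diff power_mult_distrib power_divide real_sqrt_mult)
    finally show ?thesis by simp
  qed
  ultimately have "ln Z \<le> (\<integral>x. f x \<partial>\<mu>) + L\<^sup>2 * C / 4" by (simp add: h_def)
  then show ?thesis using Z unfolding Z_def[symmetric] by (metis exp_le_cancel_iff exp_ln)
qed

text \<open>The bound involves finitely many coordinates, so \<open>F\<close> is continuous for the
  product topology; with a countable index set and second countable factors, its Borel sets are
  those of \<open>PiM UNIV\<close>.\<close>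

lemma borel_measurable_PiM_Lipschitz:
  fixes F :: "(nat \<Rightarrow> 'a::polish_space) \<Rightarrow> real"
  assumes "finite I" and L: "\<And>x y. \<bar>F x - F y\<bar> \<le> L * (\<Sum>i\<in>I. dist (x i) (y i))"
  shows "F \<in> borel_measurable (PiM I (\<lambda>_. borel))"
proof -
  have "isCont F x" for x
  proof -
    have "((\<lambda>y. L * (\<Sum>i\<in>I. dist (y i) (x i))) \<longlongrightarrow> L * (\<Sum>i\<in>I. dist (x i) (x i))) (at x)"
    proof (intro tendsto_mult tendsto_sum tendsto_dist tendsto_const)
      show "((\<lambda>y. y i) \<longlongrightarrow> x i) (at x)" for i
      proof -
        have "continuous_on UNIV (\<lambda>y::nat \<Rightarrow> 'a. y i)" by (rule continuous_on_product_coordinates)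
        then show ?thesis by (simp add: continuous_on_def)
      qed
    qed
    then have "((\<lambda>y. L * (\<Sum>i\<in>I. dist (y i) (x i))) \<longlongrightarrow> 0) (at x)" by simp
    then have "((\<lambda>y. F y - F x) \<longlongrightarrow> 0) (at x)"
      by (rule Lim_null_comparison[rotated]) (intro always_eventually allI, simp only: real_norm_def L)
    then show ?thesis by (simp add: isCont_def LIM_zero_iff)
  qed
  then have "F \<in> borel_measurable borel"
    by (intro borel_measurable_continuous_onI) (simp add: continuous_at_imp_continuous_on)
  then have 1: "F \<in> borel_measurable (PiM UNIV (\<lambda>_. borel))"
    by (subst measurable_cong_sets[OF sets_PiM_equal_borel refl])
  \<comment> \<open>Points of \<open>PiM I\<close> are \<open>undefined\<close> outside
    \<open>I\<close>, so those coordinates are constant and the identity is a measurable embedding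
    into \<open>PiM UNIV\<close>.\<close>
  have "(\<lambda>x. x) \<in> PiM I (\<lambda>_. borel) \<rightarrow>\<^sub>M PiM UNIV (\<lambda>_. borel :: 'a measure)"
  proof (rule measurable_PiM_single')
    show "(\<lambda>x. x i) \<in> PiM I (\<lambda>_. borel) \<rightarrow>\<^sub>M (borel :: 'a measure)" for i
    proof (cases "i \<in> I")
      case False
      have "(\<lambda>x. x i) \<in> PiM I (\<lambda>_. borel) \<rightarrow>\<^sub>M (borel :: 'a measure) \<longleftrightarrow>
          (\<lambda>x. undefined) \<in> PiM I (\<lambda>_. borel :: 'a measure) \<rightarrow>\<^sub>M (borel :: 'a measure)"
        by (rule measurable_cong) (use False in \<open>auto simp: space_PiM dest: PiE_arb\<close>)
      then show ?thesis by simp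
    qed simp
  qed auto
  from measurable_compose[OF this 1] show ?thesis .
qed

text \<open>Tensorization by integrating out one coordinate at a time. The one-dimensional
  hypothesis on a slice costs a factor \<open>exp c\<close> and leaves the exponential of the slice
  mean \<open>G\<close>, which is again \<open>L\<close>-Lipschitz in the remaining coordinates.
  \<open>F\<close> lives on all functions, so that \<open>F\<close> and \<open>G\<close> have one
  type and the induction can generalize over \<open>F\<close>; the bound makes \<open>F\<close>
  blind to coordinates outside \<open>I\<close>.\<close>

lemma exponential_moment_PiM:
  fixes F :: "(nat \<Rightarrow> 'a::polish_space) \<Rightarrow> real"
  assumes "prob_space \<mu>" and s[measurable_cong]: "sets \<mu> = sets borel"
    and mgf: "\<And>f B. f \<in> borel_measurable borel \<Longrightarrow> (\<And>x. \<bar>f x\<bar> \<le> B) \<Longrightarrow>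
        (\<And>x y. \<bar>f x - f y\<bar> \<le> L * dist x y) \<Longrightarrow>
        (\<integral>x. exp (f x) \<partial>\<mu>) \<le> exp ((\<integral>x. f x \<partial>\<mu>) + c)"
    and "finite I" and "L \<ge> 0" and B: "\<And>x. \<bar>F x\<bar> \<le> B"
    and L: "\<And>x y. \<bar>F x - F y\<bar> \<le> L * (\<Sum>i\<in>I. dist (x i) (y i))"
  shows "(\<integral>x. exp (F x) \<partial>PiM I (\<lambda>_. \<mu>)) \<le> exp ((\<integral>x. F x \<partial>PiM I (\<lambda>_. \<mu>)) + real (card I) * c)"
  using \<open>finite I\<close> B L
proof (induction I arbitrary: F rule: finite_induct)
  case empty
  then show ?case by (simp add: PiM_empty lebesgue_integral_count_space_finite)
next
  case (insert i I)
  interpret mu: prob_space \<mu> by fact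
  interpret product_sigma_finite "\<lambda>_. \<mu>" ..
  interpret P: prob_space "PiM I (\<lambda>_. \<mu>)" by (intro prob_space_PiM \<open>prob_space \<mu>\<close>)
  interpret Pi: prob_space "PiM (insert i I) (\<lambda>_. \<mu>)" by (intro prob_space_PiM \<open>prob_space \<mu>\<close>)
  have sP: "sets (PiM J (\<lambda>_. \<mu>)) = sets (PiM J (\<lambda>_. borel))" for J
    by (rule sets_PiM_cong) (auto simp: s)
  have mF: "F \<in> borel_measurable (PiM (insert i I) (\<lambda>_. \<mu>))"
    using borel_measurable_PiM_Lipschitz[OF _ insert.prems(2)] insert.hyps(1)
      by (simp add: measurable_cong_sets[OF sP refl])
  have expF: "exp (F x) \<le> exp B" for x using insert.prems(1)[of x] by simp
  have iF: "integrable (PiM (insert i I) (\<lambda>_. \<mu>)) F"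
    by (rule Pi.integrable_const_bound[where B=B]) (use insert.prems(1) mF in auto)
  have iE: "integrable (PiM (insert i I) (\<lambda>_. \<mu>)) (\<lambda>x. exp (F x))"
    by (rule Pi.integrable_const_bound[where B="exp B"]) (use expF mF in auto)
  have slice: "\<bar>F (x(i := z)) - F (x(i := y))\<bar> \<le> L * dist z y" for x y z
  proof -
    have "(\<Sum>j\<in>I. dist ((x(i := z)) j) ((x(i := y)) j)) = 0"
      using insert.hyps(2) by (intro sum.neutral) auto
    with insert.hyps have "(\<Sum>j\<in>insert i I. dist ((x(i := z)) j) ((x(i := y)) j)) = dist z y"
      by (subst sum.insert) auto
    with insert.prems(2)[of "x(i := z)" "x(i := y)"] show ?thesis by (simp only:)
  qed
  have mFi: "(\<lambda>y. F (x(i := y))) \<in> borel_measurable borel" for x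
  proof (intro borel_measurable_continuous_onI continuous_at_imp_continuous_on ballI)
    fix y :: 'a
    have "((\<lambda>z. L * dist z y) \<longlongrightarrow> L * dist y y) (at y)" by (intro tendsto_intros)
    then have "((\<lambda>z. L * dist z y) \<longlongrightarrow> 0) (at y)" by simp
    then have "((\<lambda>z. F (x(i := z)) - F (x(i := y))) \<longlongrightarrow> 0) (at y)"
      by (rule Lim_null_comparison[rotated]) (intro always_eventually allI, simp only: real_norm_def slice)
    then show "isCont (\<lambda>y. F (x(i := y))) y" by (simp add: isCont_def LIM_zero_iff)
  qed
  have iFi: "integrable \<mu> (\<lambda>y. F (x(i := y)))" for x
  proof (rule mu.integrable_const_bound[where B=B])
    show "(\<lambda>y. F (x(i := y))) \<in> borel_measurable \<mu>"
      using mFi measurable_cong_sets[OF s refl] by blast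
  qed (simp add: insert.prems(1) del: fun_upd_apply)
  define G where "G x = (\<integral>y. F (x(i := y)) \<partial>\<mu>)" for x
  have inner: "(\<integral>y. exp (F (x(i := y))) \<partial>\<mu>) \<le> exp (G x + c)" for x
    unfolding G_def
    by (rule mgf[OF mFi insert.prems(1) slice])
  have GB: "\<bar>G x\<bar> \<le> B" for x
  proof -
    have "\<bar>G x\<bar> \<le> (\<integral>y. \<bar>F (x(i := y))\<bar> \<partial>\<mu>)" unfolding G_def by (rule integral_abs_bound)
    also have "\<dots> \<le> (\<integral>y. B \<partial>\<mu>)"
      by (rule integral_mono) (simp_all add: iFi insert.prems(1) mu.integrable_const del: fun_upd_apply)
    finally show ?thesis by (simp add: mu.prob_space)
  qed
  have GL: "\<bar>G x - G y\<bar> \<le> L * (\<Sum>i\<in>I. dist (x i) (y i))" for x y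
  proof -
    have "\<bar>G x - G y\<bar> = \<bar>\<integral>z. F (x(i := z)) - F (y(i := z)) \<partial>\<mu>\<bar>"
      unfolding G_def by (simp add: iFi del: fun_upd_apply)
    also have "\<dots> \<le> (\<integral>z. \<bar>F (x(i := z)) - F (y(i := z))\<bar> \<partial>\<mu>)" by (rule integral_abs_bound)
    also have "\<dots> \<le> (\<integral>z. L * (\<Sum>i\<in>I. dist (x i) (y i)) \<partial>\<mu>)"
    proof (rule integral_mono)
      show "\<bar>F (x(i := z)) - F (y(i := z))\<bar> \<le> L * (\<Sum>i\<in>I. dist (x i) (y i))" for z
      proof -
        have "(\<Sum>j\<in>I. dist ((x(i := z)) j) ((y(i := z)) j)) = (\<Sum>j\<in>I. dist (x j) (y j))"
          using insert.hyps by (intro sum.cong) auto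
        with insert.hyps have "(\<Sum>j\<in>insert i I. dist ((x(i := z)) j) ((y(i := z)) j)) = (\<Sum>j\<in>I. dist (x j) (y j))"
          by (subst sum.insert) auto
        with insert.prems(2)[of "x(i := z)" "y(i := z)"] show ?thesis by (simp only:)
      qed
    qed (simp_all add: iFi mu.integrable_const del: fun_upd_apply)
    finally show ?thesis by (simp add: mu.prob_space)
  qed
  have mG: "G \<in> borel_measurable (PiM I (\<lambda>_. \<mu>))"
    using borel_measurable_PiM_Lipschitz[OF insert.hyps(1) GL] by (simp add: measurable_cong_sets[OF sP refl])
  have iG: "integrable (PiM I (\<lambda>_. \<mu>)) (\<lambda>x. exp (G x + c))"
  proof (rule P.integrable_const_bound[where B="exp (B + c)"])
    show "AE x in PiM I (\<lambda>_. \<mu>). norm (exp (G x + c)) \<le> exp (B + c)"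
      using GB by (intro always_eventually allI) (simp add: abs_le_iff)
  qed (use mG in measurable)
  have "(\<integral>x. exp (F x) \<partial>PiM (insert i I) (\<lambda>_. \<mu>)) = (\<integral>x. (\<integral>y. exp (F (x(i := y))) \<partial>\<mu>) \<partial>PiM I (\<lambda>_. \<mu>))"
    by (rule product_integral_insert) (use insert.hyps iF iE in auto)
  also have "\<dots> \<le> (\<integral>x. exp (G x + c) \<partial>PiM I (\<lambda>_. \<mu>))"
    by (rule integral_mono'[OF iG inner]) simp
  also have "\<dots> = exp c * (\<integral>x. exp (G x) \<partial>PiM I (\<lambda>_. \<mu>))"
    unfolding exp_add by simp
  also have "\<dots> \<le> exp c * exp ((\<integral>x. G x \<partial>PiM I (\<lambda>_. \<mu>)) + real (card I) * c)"
    by (intro mult_left_mono insert.IH GB GL) auto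
  also have "(\<integral>x. G x \<partial>PiM I (\<lambda>_. \<mu>)) = (\<integral>x. F x \<partial>PiM (insert i I) (\<lambda>_. \<mu>))"
    unfolding G_def by (rule product_integral_insert[symmetric]) (use insert.hyps iF iE in auto)
  also have "exp c * exp ((\<integral>x. F x \<partial>PiM (insert i I) (\<lambda>_. \<mu>)) + real (card I) * c) =
      exp ((\<integral>x. F x \<partial>PiM (insert i I) (\<lambda>_. \<mu>)) + real (card (insert i I)) * c)"
    using insert.hyps by (simp add: distrib_right flip: exp_add)
  finally show ?case .
qed

section \<open>Transport to an empirical measure\<close>

text \<open>\<open>w i y\<close> is the proportion of the mass at \<open>y\<close> that goes to the \<open>i\<close>-th sample point; indexing by \<open>i\<close> instead
  of by the point makes coinciding sample points harmless.\<close>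

definition transport_weights :: "'a::polish_space measure \<Rightarrow> nat \<Rightarrow> (nat \<Rightarrow> 'a \<Rightarrow> real) set" where
  "transport_weights \<mu> n = {w. (\<forall>i\<in>{1..n}. w i \<in> borel_measurable borel \<and> (\<forall>y. 0 \<le> w i y) \<and>
     (\<integral>y. w i y \<partial>\<mu>) = 1 / real n) \<and> (\<forall>y. (\<Sum>i=1..n. w i y) = 1)}"

definition weights_cost :: "'a::polish_space measure \<Rightarrow> nat \<Rightarrow> (nat \<Rightarrow> 'a) \<Rightarrow> (nat \<Rightarrow> 'a \<Rightarrow> real) \<Rightarrow> real" where
  "weights_cost \<mu> n x w = (\<Sum>i=1..n. \<integral>y. w i y * dist y (x i) \<partial>\<mu>)"

definition empirical_cost :: "'a::polish_space measure \<Rightarrow> nat \<Rightarrow> (nat \<Rightarrow> 'a) \<Rightarrow> real" where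
  "empirical_cost \<mu> n x = (INF w\<in>transport_weights \<mu> n. weights_cost \<mu> n x w)"

lemma integrable_dist:
  assumes "\<mu> \<in> prob_measures1"
  shows "integrable \<mu> (\<lambda>y. dist y z)"
proof -
  from assms obtain x0 where x0: "integrable \<mu> (\<lambda>x. dist x0 x)"
    and [measurable_cong]: "sets \<mu> = sets borel" and "prob_space \<mu>"
    by (auto simp: prob_measures1_def prob_measures_def)
  interpret prob_space \<mu> by fact
  have "integrable \<mu> (\<lambda>y. dist x0 y + dist x0 z)" using x0 by simp
  then show ?thesis
    by (rule Bochner_Integration.integrable_bound) (auto intro!: dist_triangle3)
qed

lemma integrable_weight_dist:
  fixes u :: "'a::polish_space \<Rightarrow> real"
  assumes mu: "\<mu> \<in> prob_measures1" and u: "u \<in> borel_measurable borel" "\<And>y. 0 \<le> u y" "\<And>y. u y \<le> 1"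
  shows "integrable \<mu> (\<lambda>y. u y * dist y z)" and "integrable \<mu> u"
proof -
  from mu have [measurable_cong]: "sets \<mu> = sets borel" and "prob_space \<mu>"
    by (auto simp: prob_measures1_def prob_measures_def)
  interpret prob_space \<mu> by fact
  note u(1)[measurable]
  show "integrable \<mu> (\<lambda>y. u y * dist y z)"
    by (rule Bochner_Integration.integrable_bound[OF integrable_dist[OF mu, of z]])
       (use u in \<open>auto simp: abs_mult mult_left_le_one_le\<close>)
  show "integrable \<mu> u"
    by (rule integrable_const_bound[where B=1]) (use u in auto)
qed

lemma transport_weights_le_1:
  assumes "w \<in> transport_weights \<mu> n" "i \<in> {1..n}"
  shows "w i y \<le> 1"
proof -
  have "w i y \<le> (\<Sum>i=1..n. w i y)"
    by (rule member_le_sum) (use assms in \<open>auto simp: transport_weights_def\<close>)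
  with assms show ?thesis by (auto simp: transport_weights_def)
qed

lemma weights_cost_nonneg:
  assumes "w \<in> transport_weights \<mu> n"
  shows "0 \<le> weights_cost \<mu> n x w"
  unfolding weights_cost_def
  using assms by (intro sum_nonneg integral_nonneg) (auto simp: transport_weights_def)

lemma const_in_transport_weights:
  assumes "prob_space \<mu>" "n \<ge> 1"
  shows "(\<lambda>_ _. 1 / real n) \<in> transport_weights \<mu> n"
  using assms by (auto simp: transport_weights_def prob_space.prob_space)

lemma weights_cost_Lipschitz:
  assumes mu: "\<mu> \<in> prob_measures1" and w: "w \<in> transport_weights \<mu> n"
  shows "weights_cost \<mu> n x w \<le> weights_cost \<mu> n y w + 1 / real n * (\<Sum>i=1..n. dist (x i) (y i))"
proof -
  have "(\<integral>z. w i z * dist z (x i) \<partial>\<mu>) \<le> (\<integral>z. w i z * dist z (y i) \<partial>\<mu>) + 1 / real n * dist (x i) (y i)"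
    if i: "i \<in> {1..n}" for i
  proof -
    have m: "w i \<in> borel_measurable borel" "\<And>z. 0 \<le> w i z" "\<And>z. w i z \<le> 1"
      using w i transport_weights_le_1[OF w i] by (auto simp: transport_weights_def)
    note int = integrable_weight_dist[OF mu m]
    have "(\<integral>z. w i z * dist z (x i) \<partial>\<mu>) \<le> (\<integral>z. w i z * dist z (y i) + w i z * dist (x i) (y i) \<partial>\<mu>)"
    proof (rule integral_mono)
      show "w i z * dist z (x i) \<le> w i z * dist z (y i) + w i z * dist (x i) (y i)" for z
        using m(2) by (simp add: dist_triangle2 mult_left_mono flip: distrib_left)
    qed (use int in auto)
    also have "\<dots> = (\<integral>z. w i z * dist z (y i) \<partial>\<mu>) + 1 / real n * dist (x i) (y i)"
      using int w i by (simp add: transport_weights_def)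
    finally show ?thesis .
  qed
  then show ?thesis
    unfolding weights_cost_def sum_distrib_left sum.distrib[symmetric] by (rule sum_mono)
qed

lemma empirical_cost_le:
  assumes "w \<in> transport_weights \<mu> n"
  shows "empirical_cost \<mu> n x \<le> weights_cost \<mu> n x w"
  unfolding empirical_cost_def
  by (rule cINF_lower[OF _ assms]) (auto intro!: bdd_belowI2[where m=0] weights_cost_nonneg)

lemma empirical_cost_nonneg:
  assumes "prob_space \<mu>" "n \<ge> 1"
  shows "0 \<le> empirical_cost \<mu> n x"
  unfolding empirical_cost_def
  by (rule cINF_greatest) (use const_in_transport_weights[OF assms] weights_cost_nonneg in auto)

lemma empirical_cost_Lipschitz:
  assumes mu: "\<mu> \<in> prob_measures1" and "n \<ge> 1"
  shows "\<bar>empirical_cost \<mu> n x - empirical_cost \<mu> n y\<bar> \<le> 1 / real n * (\<Sum>i=1..n. dist (x i) (y i))"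
proof -
  have ne: "transport_weights \<mu> n \<noteq> {}"
    using const_in_transport_weights[of \<mu> n] assms by (auto simp: prob_measures1_def prob_measures_def)
  have le: "empirical_cost \<mu> n x - 1 / real n * (\<Sum>i=1..n. dist (x i) (y i)) \<le> empirical_cost \<mu> n y" for x y
    unfolding empirical_cost_def[of \<mu> n y]
  proof (rule cINF_greatest[OF ne])
    fix w assume w: "w \<in> transport_weights \<mu> n"
    show "empirical_cost \<mu> n x - 1 / real n * (\<Sum>i=1..n. dist (x i) (y i)) \<le> weights_cost \<mu> n y w"
      using empirical_cost_le[OF w, of x] weights_cost_Lipschitz[OF mu w, of x y] by simp
  qed
  show ?thesis using le[of x y] le[of y x] by (simp add: dist_commute)
qed

text \<open>The coupling is the law of \<open>(y, x i)\<close> when \<open>(i, y)\<close> has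
  density \<open>w i y\<close> with respect to counting measure times \<open>\<mu>\<close>. The
  weights summing to 1 give the first marginal, their masses \<open>1 / n\<close> the
  second.\<close>

lemma W1_empirical_le_weights_cost:
  assumes mu: "\<mu> \<in> prob_measures1" and w: "w \<in> transport_weights \<mu> n" and "n \<ge> 1"
  shows "W1 \<mu> (empirical_measure n x) \<le> ennreal (weights_cost \<mu> n x w)"
proof -
  from mu have s[measurable_cong]: "sets \<mu> = sets borel" and "prob_space \<mu>"
    by (auto simp: prob_measures1_def prob_measures_def)
  interpret prob_space \<mu> by fact
  have m: "w i \<in> borel_measurable borel" "\<And>z. 0 \<le> w i z" "(\<integral>y. w i y \<partial>\<mu>) = 1 / real n" if "i \<in> {1..n}" for i
    using w that by (auto simp: transport_weights_def)
  have int: "integrable \<mu> (\<lambda>y. w i y * dist y z)" "integrable \<mu> (w i)" if "i \<in> {1..n}" for i z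
    using integrable_weight_dist[OF mu m(1,2) transport_weights_le_1[OF w]] that by blast+
  have m\<mu>: "w i \<in> borel_measurable \<mu>" if "i \<in> {1..n}" for i
    using m(1)[OF that] by (simp add: measurable_cong_sets[OF s refl])
  define Q where "Q = count_space {1..n} \<Otimes>\<^sub>M \<mu>"
  have mw[measurable]: "(\<lambda>(i, y). ennreal (w i y)) \<in> borel_measurable Q"
    unfolding Q_def by (rule measurable_pair_measure_countable1) (use m\<mu> in auto)
  have mx[measurable]: "(\<lambda>(i, y). (y, x i)) \<in> Q \<rightarrow>\<^sub>M (borel \<Otimes>\<^sub>M borel)"
    unfolding Q_def by (rule measurable_pair_measure_countable1) auto
  define \<pi> where "\<pi> = distr (density Q (\<lambda>(i, y). ennreal (w i y))) (borel \<Otimes>\<^sub>M borel) (\<lambda>(i, y). (y, x i))"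
  \<comment> \<open>The two marginals and the cost are all instances of this formula.\<close>
  have nn: "(\<integral>\<^sup>+ z. h z \<partial>\<pi>) = (\<Sum>i=1..n. \<integral>\<^sup>+ y. ennreal (w i y) * h (y, x i) \<partial>\<mu>)"
    if [measurable]: "h \<in> borel_measurable (borel \<Otimes>\<^sub>M borel)" for h
  proof -
    have "(\<integral>\<^sup>+ z. h z \<partial>\<pi>) = (\<integral>\<^sup>+ q. (case q of (i, y) \<Rightarrow> ennreal (w i y)) * h (case q of (i, y) \<Rightarrow> (y, x i)) \<partial>Q)"
      unfolding \<pi>_def by (simp add: nn_integral_distr nn_integral_density)
    also have "\<dots> = (\<integral>\<^sup>+ i. \<integral>\<^sup>+ y. ennreal (w i y) * h (y, x i) \<partial>\<mu> \<partial>count_space {1..n})"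
    proof -
      have "(\<lambda>q. (case q of (i, y) \<Rightarrow> ennreal (w i y)) * h (case q of (i, y) \<Rightarrow> (y, x i)))
          \<in> borel_measurable (count_space {1..n} \<Otimes>\<^sub>M \<mu>)"
        unfolding Q_def[symmetric] by measurable
      from nn_integral_fst[OF this] show ?thesis by (simp add: Q_def)
    qed
    finally show ?thesis by (simp add: nn_integral_count_space_finite)
  qed
  have s\<pi>: "sets \<pi> = sets (borel \<Otimes>\<^sub>M borel)" by (simp add: \<pi>_def)
  have fst: "distr \<pi> borel fst = \<mu>"
  proof (rule measure_eqI)
    fix A assume "A \<in> sets (distr \<pi> borel fst)"
    then have [measurable]: "A \<in> sets borel" by simp
    have "emeasure (distr \<pi> borel fst) A = (\<integral>\<^sup>+ z. indicator A (fst z) \<partial>\<pi>)"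
      by (subst nn_integral_distr[of fst \<pi> borel "indicator A", symmetric]) (auto simp: \<pi>_def)
    also have "\<dots> = (\<Sum>i=1..n. \<integral>\<^sup>+ y. ennreal (w i y) * indicator A y \<partial>\<mu>)" by (simp add: nn)
    also have "\<dots> = (\<integral>\<^sup>+ y. (\<Sum>i=1..n. ennreal (w i y) * indicator A y) \<partial>\<mu>)"
      by (rule nn_integral_sum[symmetric]) (use m\<mu> in auto)
    also have "\<dots> = (\<integral>\<^sup>+ y. indicator A y \<partial>\<mu>)"
    proof (rule nn_integral_cong)
      fix y
      have "(\<Sum>i=1..n. ennreal (w i y)) = ennreal (\<Sum>i=1..n. w i y)"
        by (rule sum_ennreal) (use m in auto)
      also have "\<dots> = 1" using w by (simp add: transport_weights_def)
      finally show "(\<Sum>i=1..n. ennreal (w i y) * indicator A y) = indicator A y"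
        by (simp flip: sum_distrib_right)
    qed
    finally show "emeasure (distr \<pi> borel fst) A = emeasure \<mu> A" by simp
  qed (simp add: s)
  have snd: "distr \<pi> borel snd = empirical_measure n x"
  proof (rule measure_eqI)
    fix A assume "A \<in> sets (distr \<pi> borel snd)"
    then have [measurable]: "A \<in> sets borel" by simp
    have "emeasure (distr \<pi> borel snd) A = (\<integral>\<^sup>+ z. indicator A (snd z) \<partial>\<pi>)"
      by (subst nn_integral_distr[of snd \<pi> borel "indicator A", symmetric]) (auto simp: \<pi>_def)
    also have "\<dots> = (\<Sum>i=1..n. \<integral>\<^sup>+ y. ennreal (w i y) * indicator A (x i) \<partial>\<mu>)" by (simp add: nn)
    also have "\<dots> = (\<Sum>i=1..n. ennreal (1 / real n) * indicator A (x i))"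
    proof (rule sum.cong[OF refl])
      fix i assume i: "i \<in> {1..n}"
      have "(\<integral>\<^sup>+ y. ennreal (w i y) \<partial>\<mu>) = ennreal (1 / real n)"
        using int(2)[OF i] m[OF i] by (simp add: nn_integral_eq_integral)
      then show "(\<integral>\<^sup>+ y. ennreal (w i y) * indicator A (x i) \<partial>\<mu>) = ennreal (1 / real n) * indicator A (x i)"
        using m\<mu>[OF i] by (simp add: nn_integral_multc)
    qed
    also have "\<dots> = (\<Sum>i=1..n. indicator A (x i)) / of_nat n"
    proof -
      have "ennreal (1 / real n) = inverse (of_nat n)"
        using \<open>n \<ge> 1\<close> by (simp add: divide_ennreal_def ennreal_of_nat_eq_real_of_nat flip: divide_ennreal)
      then show ?thesis by (simp add: divide_ennreal_def mult.commute flip: sum_distrib_left)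
    qed
    finally show "emeasure (distr \<pi> borel snd) A = emeasure (empirical_measure n x) A"
      by (simp add: emeasure_empirical_measure)
  qed simp
  have "prob_space \<pi>"
  proof (rule prob_space_distrD)
    show "fst \<in> \<pi> \<rightarrow>\<^sub>M (borel :: 'a measure)" by (simp add: \<pi>_def)
    show "prob_space (distr \<pi> borel fst)" by (simp add: fst \<open>prob_space \<mu>\<close>)
  qed
  with s\<pi> fst snd have "\<pi> \<in> couplings \<mu> (empirical_measure n x)" by (simp add: couplings_def)
  then have "W1 \<mu> (empirical_measure n x) \<le> (\<integral>\<^sup>+ z. ennreal (dist (fst z) (snd z)) \<partial>\<pi>)"
    unfolding W1_def by (rule INF_lower)
  also have "\<dots> = (\<Sum>i=1..n. \<integral>\<^sup>+ y. ennreal (w i y) * ennreal (dist y (x i)) \<partial>\<mu>)"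
    by (simp add: nn)
  also have "\<dots> = (\<Sum>i=1..n. ennreal (\<integral>y. w i y * dist y (x i) \<partial>\<mu>))"
    using int(1) m(2) by (intro sum.cong refl) (simp add: nn_integral_eq_integral flip: ennreal_mult)
  also have "\<dots> = ennreal (weights_cost \<mu> n x w)"
    unfolding weights_cost_def using m(2) by (intro sum_ennreal integral_nonneg) simp
  finally show ?thesis .
qed

lemma W1_empirical_le_empirical_cost:
  assumes mu: "\<mu> \<in> prob_measures1" and "n \<ge> 1"
  shows "W1 \<mu> (empirical_measure n x) \<le> ennreal (empirical_cost \<mu> n x)"
proof -
  have ne: "transport_weights \<mu> n \<noteq> {}"
    using const_in_transport_weights[of \<mu> n] assms by (auto simp: prob_measures1_def prob_measures_def)
  then obtain w where w: "w \<in> transport_weights \<mu> n" by auto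
  \<comment> \<open>\<open>enn2real\<close> maps infinity to 0, so finiteness is secured before the
    comparison with an infimum of reals.\<close>
  have fin: "W1 \<mu> (empirical_measure n x) < top"
    by (rule le_less_trans[OF W1_empirical_le_weights_cost[OF mu w \<open>n \<ge> 1\<close>, of x] ennreal_less_top])
  have "enn2real (W1 \<mu> (empirical_measure n x)) \<le> empirical_cost \<mu> n x"
    unfolding empirical_cost_def
  proof (rule cINF_greatest[OF ne])
    fix w assume w: "w \<in> transport_weights \<mu> n"
    show "enn2real (W1 \<mu> (empirical_measure n x)) \<le> weights_cost \<mu> n x w"
      using W1_empirical_le_weights_cost[OF mu w \<open>n \<ge> 1\<close>, of x] weights_cost_nonneg[OF w]
      by (simp add: enn2real_leI)
  qed
  then show ?thesis using fin by (metis ennreal_enn2real ennreal_leI)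
qed

section \<open>Discretization along a finitely supported measure\<close>

text \<open>\<open>u k y\<close> is the conditional probability under \<open>\<pi>\<close> that the
  second coordinate is \<open>k\<close> when the first is \<open>y\<close>. With finitely many
  values of \<open>k\<close>, Radon-Nikodym derivatives of finitely many measures replace a
  disintegration into kernels.\<close>

lemma finite_coupling_disintegration:
  fixes \<mu> \<nu> :: "'a::polish_space measure"
  assumes mu: "\<mu> \<in> prob_measures" and pi: "\<pi> \<in> couplings \<mu> \<nu>"
    and fin: "finite S" and AE_S: "AE y in \<nu>. y \<in> S"
  shows "\<exists>u. (\<forall>k\<in>S. u k \<in> borel_measurable borel) \<and> (\<forall>k y. 0 \<le> u k y) \<and>
    (\<forall>y. (\<Sum>k\<in>S. u k y) = 1) \<and> (\<forall>k\<in>S. (\<integral>y. u k y \<partial>\<mu>) = measure \<nu> {k}) \<and>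
    (\<Sum>k\<in>S. \<integral>\<^sup>+ y. ennreal (u k y * dist y k) \<partial>\<mu>) \<le> (\<integral>\<^sup>+ z. ennreal (dist (fst z) (snd z)) \<partial>\<pi>)"
proof -
  from mu have s[measurable_cong]: "sets \<mu> = sets borel" and "prob_space \<mu>"
    by (auto simp: prob_measures_def)
  interpret prob_space \<mu> by fact
  from pi have s\<pi>[measurable_cong]: "sets \<pi> = sets (borel \<Otimes>\<^sub>M borel)" and "prob_space \<pi>"
    and d: "distr \<pi> borel fst = \<mu>" "distr \<pi> borel snd = \<nu>"
    by (auto simp: couplings_def)
  interpret pi: prob_space \<pi> by fact
  have fst_m[measurable]: "fst \<in> \<pi> \<rightarrow>\<^sub>M (borel :: 'a measure)"
    and snd_m[measurable]: "snd \<in> \<pi> \<rightarrow>\<^sub>M (borel :: 'a measure)"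
    by measurable
  have AE_pi: "AE z in \<pi>. snd z \<in> S"
    using AE_S fin unfolding d(2)[symmetric] by (subst (asm) AE_distr_iff) (auto simp: finite_imp_closed borel_closed)
  have "S \<noteq> {}"
  proof
    assume "S = {}"
    with AE_pi have "AE z in \<pi>. False" by simp
    then show False by simp
  qed
  then obtain k0 where k0: "k0 \<in> S" by auto
  \<comment> \<open>The first marginal of \<open>\<pi>\<close> restricted to second coordinate
    \<open>k\<close>; it is dominated by \<open>\<mu>\<close>, hence has a density.\<close>
  define \<rho> where "\<rho> k = distr (density \<pi> (\<lambda>z. indicator {k} (snd z))) borel fst" for k
  have nn\<rho>: "(\<integral>\<^sup>+ y. h y \<partial>\<rho> k) = (\<integral>\<^sup>+ z. indicator {k} (snd z) * h (fst z) \<partial>\<pi>)"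
    if [measurable]: "h \<in> borel_measurable borel" for h :: "'a \<Rightarrow> ennreal" and k
    unfolding \<rho>_def by (subst nn_integral_distr) (simp_all add: nn_integral_density)
  have em\<rho>: "emeasure (\<rho> k) A = (\<integral>\<^sup>+ z. indicator {k} (snd z) * indicator A (fst z) \<partial>\<pi>)"
    if "A \<in> sets borel" for A k
    using nn\<rho>[of "indicator A" k] that by (simp add: \<rho>_def)
  have em\<mu>: "emeasure \<mu> A = (\<integral>\<^sup>+ z. indicator A (fst z) \<partial>\<pi>)" if "A \<in> sets borel" for A
  proof -
    have "(\<integral>\<^sup>+ y. indicator A y \<partial>\<mu>) = (\<integral>\<^sup>+ z. indicator A (fst z) \<partial>\<pi>)"
      unfolding d(1)[symmetric] using that by (subst nn_integral_distr) simp_all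
    then show ?thesis using that by (simp add: s)
  qed
  have s\<rho>: "sets (\<rho> k) = sets \<mu>" for k by (simp add: \<rho>_def s)
  have ac: "absolutely_continuous \<mu> (\<rho> k)" for k
    unfolding absolutely_continuous_def
  proof
    fix A assume "A \<in> null_sets \<mu>"
    then have A: "A \<in> sets borel" "emeasure \<mu> A = 0" by (auto simp: null_sets_def s)
    have "emeasure (\<rho> k) A \<le> emeasure \<mu> A"
      unfolding em\<rho>[OF A(1)] em\<mu>[OF A(1)] by (intro nn_integral_mono) (auto simp: indicator_def)
    with A show "A \<in> null_sets (\<rho> k)" by (auto simp: null_sets_def s\<rho> s)
  qed
  define r where "r k = RN_deriv \<mu> (\<rho> k)" for k
  have r_m[measurable]: "r k \<in> borel_measurable borel" for k
    using borel_measurable_RN_deriv[of \<mu> "\<rho> k"] unfolding r_def by (simp add: measurable_cong_sets[OF s refl])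
  have dens: "density \<mu> (r k) = \<rho> k" for k
    unfolding r_def by (rule density_RN_deriv[OF ac s\<rho>])
  have sum_ind: "AE z in \<pi>. (\<Sum>k\<in>S. indicator {k} (snd z)) = (1::ennreal)"
    using AE_pi by eventually_elim (use fin in \<open>simp add: indicator_def\<close>)
  \<comment> \<open>The measures \<open>\<rho> k\<close> add up to \<open>\<mu>\<close>, because
    almost surely exactly one of the indicators is 1. Uniqueness of densities turns this into a
    statement about the sum of the \<open>r k\<close>.\<close>
  have eq: "density \<mu> (\<lambda>y. \<Sum>k\<in>S. r k y) = density \<mu> (\<lambda>_. 1)"
  proof (rule measure_eqI)
    fix A assume "A \<in> sets (density \<mu> (\<lambda>y. \<Sum>k\<in>S. r k y))"
    then have A[measurable]: "A \<in> sets borel" by (simp add: s)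
    have "emeasure (density \<mu> (\<lambda>y. \<Sum>k\<in>S. r k y)) A = (\<integral>\<^sup>+ y. (\<Sum>k\<in>S. r k y * indicator A y) \<partial>\<mu>)"
      by (subst emeasure_density) (auto simp: sum_distrib_right)
    also have "\<dots> = (\<Sum>k\<in>S. \<integral>\<^sup>+ y. r k y * indicator A y \<partial>\<mu>)"
      by (rule nn_integral_sum) measurable
    also have "\<dots> = (\<Sum>k\<in>S. emeasure (\<rho> k) A)"
      unfolding dens[symmetric] by (intro sum.cong refl) (subst emeasure_density; simp add: s)
    also have "\<dots> = (\<Sum>k\<in>S. \<integral>\<^sup>+ z. indicator {k} (snd z) * indicator A (fst z) \<partial>\<pi>)"
      by (simp add: em\<rho>)
    also have "\<dots> = (\<integral>\<^sup>+ z. (\<Sum>k\<in>S. indicator {k} (snd z) * indicator A (fst z)) \<partial>\<pi>)"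
      by (rule nn_integral_sum[symmetric]) measurable
    also have "\<dots> = (\<integral>\<^sup>+ z. indicator A (fst z) \<partial>\<pi>)"
      by (rule nn_integral_cong_AE) (use sum_ind in eventually_elim, simp flip: sum_distrib_right)
    also have "\<dots> = emeasure \<mu> A" by (simp add: em\<mu>)
    finally show "emeasure (density \<mu> (\<lambda>y. \<Sum>k\<in>S. r k y)) A = emeasure (density \<mu> (\<lambda>_. 1)) A"
      by (simp add: density_1)
  qed simp
  have "sigma_finite_measure (density \<mu> (\<lambda>y. \<Sum>k\<in>S. r k y))"
    unfolding eq by (simp add: density_1 sigma_finite_measure_axioms)
  then have AE_r: "AE y in \<mu>. (\<Sum>k\<in>S. r k y) = 1"
    using eq sigma_finite_density_unique[of "\<lambda>y. \<Sum>k\<in>S. r k y" \<mu> "\<lambda>_. 1"] by simp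
  \<comment> \<open>The densities sum to 1 only almost everywhere; on the exceptional null set all mass goes to \<open>k0\<close>.\<close>
  define u where "u k y = (if (\<Sum>j\<in>S. r j y) = 1 then enn2real (r k y) else if k = k0 then 1 else 0)" for k y
  have u_m[measurable]: "u k \<in> borel_measurable borel" for k
    unfolding u_def by measurable
  have u0: "0 \<le> u k y" for k y by (simp add: u_def)
  have r_fin: "r k y < top" if "(\<Sum>j\<in>S. r j y) = 1" "k \<in> S" for k y
  proof -
    have "r k y \<le> (\<Sum>j\<in>S. r j y)" by (rule member_le_sum) (use that fin in auto)
    also have "\<dots> < top" using that by simp
    finally show ?thesis .
  qed
  have AE_u: "AE y in \<mu>. ennreal (u k y) = r k y" if "k \<in> S" for k
    using AE_r by eventually_elim (use r_fin[OF _ that] in \<open>simp add: u_def\<close>)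
  have u_sum: "(\<Sum>k\<in>S. u k y) = 1" for y
  proof (cases "(\<Sum>j\<in>S. r j y) = 1")
    case True
    have "ennreal (\<Sum>k\<in>S. u k y) = (\<Sum>k\<in>S. r k y)"
      using True r_fin by (subst sum_ennreal[symmetric]) (auto simp: u_def intro!: sum.cong)
    then show ?thesis using True by (simp add: sum_nonneg u0)
  next
    case False
    then show ?thesis using k0 fin by (simp add: u_def)
  qed
  \<comment> \<open>Used with \<open>h = 1\<close> for the masses of the atoms and with
    \<open>h\<close> the distance to \<open>k\<close> for the cost.\<close>
  have nnu: "(\<integral>\<^sup>+ y. ennreal (u k y) * h y \<partial>\<mu>) = (\<integral>\<^sup>+ z. indicator {k} (snd z) * h (fst z) \<partial>\<pi>)"
    if "k \<in> S" and h: "h \<in> borel_measurable borel" for h k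
  proof -
    have "(\<integral>\<^sup>+ y. ennreal (u k y) * h y \<partial>\<mu>) = (\<integral>\<^sup>+ y. r k y * h y \<partial>\<mu>)"
      by (rule nn_integral_cong_AE) (use AE_u[OF that(1)] in eventually_elim, simp)
    also have "\<dots> = (\<integral>\<^sup>+ y. h y \<partial>\<rho> k)"
      unfolding dens[symmetric] using h
      by (subst nn_integral_density) (simp_all add: measurable_cong_sets[OF s refl])
    finally show ?thesis using nn\<rho>[OF h] by simp
  qed
  show ?thesis
  proof (intro exI[of _ u] conjI ballI allI)
    show "(\<integral>y. u k y \<partial>\<mu>) = measure \<nu> {k}" if "k \<in> S" for k
    proof -
      have "(\<integral>y. u k y \<partial>\<mu>) = enn2real (\<integral>\<^sup>+ y. ennreal (u k y) \<partial>\<mu>)"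
        by (rule integral_eq_nn_integral) (use u_m u0 in \<open>auto simp: measurable_cong_sets[OF s refl]\<close>)
      also have "(\<integral>\<^sup>+ y. ennreal (u k y) \<partial>\<mu>) = (\<integral>\<^sup>+ z. indicator {k} (snd z) \<partial>\<pi>)"
        using nnu[OF that, of "\<lambda>_. 1"] by simp
      also have "\<dots> = (\<integral>\<^sup>+ y. indicator {k} y \<partial>\<nu>)"
        unfolding d(2)[symmetric] by (subst nn_integral_distr) simp_all
      also have "\<dots> = emeasure \<nu> {k}"
        unfolding d(2)[symmetric] by simp
      finally show ?thesis by (simp add: measure_def)
    qed
    have "(\<Sum>k\<in>S. \<integral>\<^sup>+ y. ennreal (u k y * dist y k) \<partial>\<mu>) =
        (\<Sum>k\<in>S. \<integral>\<^sup>+ z. indicator {k} (snd z) * ennreal (dist (fst z) k) \<partial>\<pi>)"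
      using nnu[of _ "\<lambda>y. ennreal (dist y _)"] by (intro sum.cong refl) (simp add: ennreal_mult u0)
    also have "\<dots> = (\<integral>\<^sup>+ z. (\<Sum>k\<in>S. indicator {k} (snd z) * ennreal (dist (fst z) k)) \<partial>\<pi>)"
      by (rule nn_integral_sum[symmetric]) measurable
    also have "\<dots> \<le> (\<integral>\<^sup>+ z. ennreal (dist (fst z) (snd z)) \<partial>\<pi>)"
    proof (rule nn_integral_mono)
      fix z
      have "(\<Sum>k\<in>S. indicator {k} (snd z) * ennreal (dist (fst z) k)) =
          (\<Sum>k\<in>S. if snd z = k then ennreal (dist (fst z) (snd z)) else 0)"
        by (intro sum.cong) (auto simp: indicator_def)
      also have "\<dots> \<le> ennreal (dist (fst z) (snd z))"
        using fin by simp
      finally show "(\<Sum>k\<in>S. indicator {k} (snd z) * ennreal (dist (fst z) k)) \<le> ennreal (dist (fst z) (snd z))" .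
    qed
    finally show "(\<Sum>k\<in>S. \<integral>\<^sup>+ y. ennreal (u k y * dist y k) \<partial>\<mu>) \<le> (\<integral>\<^sup>+ z. ennreal (dist (fst z) (snd z)) \<partial>\<pi>)" .
  qed (rule u_m u0 u_sum)+
qed

text \<open>The common mass \<open>min p q\<close> stays in place and the excess is distributed proportionally.\<close>

lemma finite_transport_plan:
  fixes p q :: "'k \<Rightarrow> real"
  assumes fin: "finite S" and p: "\<And>k. k \<in> S \<Longrightarrow> 0 \<le> p k" and q: "\<And>k. k \<in> S \<Longrightarrow> 0 \<le> q k"
    and eq: "sum p S = sum q S"
  shows "\<exists>R. (\<forall>k\<in>S. \<forall>l\<in>S. 0 \<le> R k l) \<and> (\<forall>k\<in>S. (\<Sum>l\<in>S. R k l) = p k) \<and>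
    (\<forall>l\<in>S. (\<Sum>k\<in>S. R k l) = q l) \<and>
    (\<Sum>k\<in>S. \<Sum>l\<in>S. if k = l then 0 else R k l) \<le> (\<Sum>k\<in>S. \<bar>p k - q k\<bar>)"
proof -
  define a b where "a k = max 0 (p k - q k)" and "b k = max 0 (q k - p k)" for k
  have ab: "0 \<le> a k" "0 \<le> b k" "a k - b k = p k - q k" "min (p k) (q k) + a k = p k"
    "min (p k) (q k) + b k = q k" "a k \<le> \<bar>p k - q k\<bar>" for k
    by (auto simp: a_def b_def)
  define T where "T = sum a S"
  have T: "T = sum b S"
  proof -
    have "sum a S - sum b S = (\<Sum>k\<in>S. p k - q k)" by (simp add: ab(3) flip: sum_subtractf)
    with eq show ?thesis by (simp add: T_def sum_subtractf)
  qed
  have T0: "0 \<le> T" unfolding T_def by (rule sum_nonneg) (rule ab)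
  \<comment> \<open>If \<open>T = 0\<close>, all excesses vanish, so the division by zero in
    \<open>R\<close> below still leaves the right marginals.\<close>
  have aT: "a k * T / T = a k" if "k \<in> S" for k
    using that fin ab(1) by (cases "T = 0") (auto simp: T_def sum_nonneg_eq_0_iff)
  have bT: "T * b k / T = b k" if "k \<in> S" for k
    using that fin ab(2) by (cases "T = 0") (auto simp: T sum_nonneg_eq_0_iff)
  define R where "R k l = (if k = l then min (p k) (q k) else 0) + a k * b l / T" for k l
  show ?thesis
  proof (intro exI[of _ R] conjI ballI)
    show "0 \<le> R k l" if "k \<in> S" "l \<in> S" for k l
      using that p q ab T0 by (simp add: R_def)
    show "(\<Sum>l\<in>S. R k l) = p k" if "k \<in> S" for k
    proof -
      have "(\<Sum>l\<in>S. R k l) = min (p k) (q k) + a k * T / T"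
        unfolding R_def T using that fin
        by (simp add: sum.distrib sum_distrib_left sum_divide_distrib)
      then show ?thesis using aT[OF that] ab(4) by simp
    qed
    show "(\<Sum>k\<in>S. R k l) = q l" if "l \<in> S" for l
    proof -
      have "(\<Sum>k\<in>S. R k l) = min (p l) (q l) + T * b l / T"
        unfolding R_def T_def using that fin
        by (simp add: sum.distrib sum_distrib_right sum_divide_distrib)
      then show ?thesis using bT[OF that] ab(5) by simp
    qed
    \<comment> \<open>Off the diagonal only \<open>a k * b l / T\<close> is left, with total at most
      \<open>T\<close>, the sum of the positive parts of \<open>p - q\<close>.\<close>
    have "(\<Sum>k\<in>S. \<Sum>l\<in>S. if k = l then 0 else R k l) \<le> (\<Sum>k\<in>S. \<Sum>l\<in>S. a k * b l / T)"
      using ab T0 by (intro sum_mono) (auto simp: R_def)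
    also have "\<dots> = (\<Sum>k\<in>S. a k * T / T)"
      unfolding T by (simp add: sum_distrib_left sum_divide_distrib)
    also have "\<dots> = (\<Sum>k\<in>S. a k)" by (intro sum.cong refl aT)
    also have "\<dots> \<le> (\<Sum>k\<in>S. \<bar>p k - q k\<bar>)" by (intro sum_mono ab)
    finally show "(\<Sum>k\<in>S. \<Sum>l\<in>S. if k = l then 0 else R k l) \<le> (\<Sum>k\<in>S. \<bar>p k - q k\<bar>)" .
  qed
qed

text \<open>Gluing of two finite plans: \<open>R\<close> corrects the masses \<open>p\<close> to the
  first marginal \<open>q\<close> of \<open>v\<close>, and \<open>v l i / q l\<close> then
  distributes the mass at \<open>l\<close> over the indices \<open>i\<close>. Correcting costs at
  most \<open>D\<close> per unit of mass moved; the second leg costs what \<open>v\<close> costs. In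
  the application \<open>p\<close> holds the atoms of \<open>\<nu>\<close> and \<open>v\<close> the
  discretized sample.\<close>

lemma finite_gluing:
  fixes x :: "'i \<Rightarrow> 'a::metric_space" and v :: "'a \<Rightarrow> 'i \<Rightarrow> real"
  assumes fin: "finite S" "finite I" and p: "\<And>k. k \<in> S \<Longrightarrow> 0 \<le> p k"
    and v: "\<And>k i. k \<in> S \<Longrightarrow> i \<in> I \<Longrightarrow> 0 \<le> v k i"
    and eq: "sum p S = (\<Sum>k\<in>S. \<Sum>i\<in>I. v k i)"
    and D: "0 \<le> D" "\<And>k l. k \<in> S \<Longrightarrow> l \<in> S \<Longrightarrow> dist k l \<le> D"
  shows "\<exists>T. (\<forall>k\<in>S. \<forall>i\<in>I. 0 \<le> T k i) \<and> (\<forall>k\<in>S. (\<Sum>i\<in>I. T k i) = p k) \<and>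
    (\<forall>i\<in>I. (\<Sum>k\<in>S. T k i) = (\<Sum>k\<in>S. v k i)) \<and>
    (\<Sum>k\<in>S. \<Sum>i\<in>I. T k i * dist k (x i)) \<le>
       D * (\<Sum>k\<in>S. \<bar>p k - (\<Sum>i\<in>I. v k i)\<bar>) + (\<Sum>k\<in>S. \<Sum>i\<in>I. v k i * dist k (x i))"
proof -
  define q where "q k = (\<Sum>i\<in>I. v k i)" for k
  have q: "0 \<le> q k" if "k \<in> S" for k unfolding q_def using v that by (intro sum_nonneg) auto
  obtain R where R: "\<And>k l. k \<in> S \<Longrightarrow> l \<in> S \<Longrightarrow> 0 \<le> R k l"
    "\<And>k. k \<in> S \<Longrightarrow> (\<Sum>l\<in>S. R k l) = p k" "\<And>l. l \<in> S \<Longrightarrow> (\<Sum>k\<in>S. R k l) = q l"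
    "(\<Sum>k\<in>S. \<Sum>l\<in>S. if k = l then 0 else R k l) \<le> (\<Sum>k\<in>S. \<bar>p k - q k\<bar>)"
    using finite_transport_plan[of S p q, OF fin(1) p q eq[folded q_def]] by blast
  \<comment> \<open>For \<open>q l = 0\<close> the junk value \<open>V l i = 0\<close> is harmless, since then \<open>R k l = 0\<close>.\<close>
  define V where "V l i = v l i / q l" for l i
  have V0: "0 \<le> V l i" if "l \<in> S" "i \<in> I" for l i using that v q by (simp add: V_def)
  have RV: "R k l * (\<Sum>i\<in>I. V l i) = R k l" if "k \<in> S" "l \<in> S" for k l
  proof (cases "q l = 0")
    case True
    with R(3)[of l] that have "(\<Sum>k\<in>S. R k l) = 0" by simp
    then have "R k l = 0"
      using sum_nonneg_eq_0_iff[of S "\<lambda>k. R k l"] R(1) that fin by simp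
    then show ?thesis by simp
  next
    case False
    then have "(\<Sum>i\<in>I. V l i) = 1" by (simp add: V_def q_def flip: sum_divide_distrib)
    then show ?thesis by simp
  qed
  have qV: "q l * V l i = v l i" if "l \<in> S" "i \<in> I" for l i
    using that v fin by (cases "q l = 0") (auto simp: V_def q_def sum_nonneg_eq_0_iff)
  define T where "T k i = (\<Sum>l\<in>S. R k l * V l i)" for k i
  show ?thesis
  proof (intro exI[of _ T] conjI ballI)
    show "0 \<le> T k i" if "k \<in> S" "i \<in> I" for k i
      unfolding T_def using that R(1) V0 by (intro sum_nonneg) auto
    show "(\<Sum>i\<in>I. T k i) = p k" if "k \<in> S" for k
    proof -
      have "(\<Sum>i\<in>I. T k i) = (\<Sum>l\<in>S. R k l * (\<Sum>i\<in>I. V l i))"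
        unfolding T_def by (subst sum.swap) (simp add: sum_distrib_left)
      also have "\<dots> = (\<Sum>l\<in>S. R k l)" by (intro sum.cong refl RV that)
      also have "\<dots> = p k" by (rule R(2)[OF that])
      finally show ?thesis .
    qed
    \<comment> \<open>Summing out the starting point \<open>k\<close> turns \<open>R\<close> into
      \<open>q\<close>, and \<open>q l * V l i\<close> is \<open>v l i\<close>. The choice
      \<open>c = 1\<close> gives the second marginal of \<open>T\<close>, and \<open>c\<close> a
      distance gives the cost of the second leg.\<close>
    have swap: "(\<Sum>k\<in>S. \<Sum>l\<in>S. R k l * (V l i * c l)) = (\<Sum>l\<in>S. v l i * c l)" if "i \<in> I" for i c
    proof -
      have "(\<Sum>k\<in>S. \<Sum>l\<in>S. R k l * (V l i * c l)) = (\<Sum>l\<in>S. q l * (V l i * c l))"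
        by (subst sum.swap) (simp add: R(3) flip: sum_distrib_right)
      also have "\<dots> = (\<Sum>l\<in>S. v l i * c l)"
        using qV that by (intro sum.cong) (simp_all flip: mult.assoc)
      finally show ?thesis .
    qed
    show "(\<Sum>k\<in>S. T k i) = (\<Sum>k\<in>S. v k i)" if "i \<in> I" for i
      using swap[OF that, of "\<lambda>_. 1"] by (simp add: T_def)
    have "(\<Sum>k\<in>S. \<Sum>i\<in>I. T k i * dist k (x i)) = (\<Sum>k\<in>S. \<Sum>i\<in>I. \<Sum>l\<in>S. R k l * V l i * dist k (x i))"
      by (simp add: T_def sum_distrib_right)
    also have "\<dots> \<le> (\<Sum>k\<in>S. \<Sum>i\<in>I. \<Sum>l\<in>S. R k l * V l i * dist k l + R k l * (V l i * dist l (x i)))"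
    proof (intro sum_mono)
      fix k i l assume "k \<in> S" "i \<in> I" "l \<in> S"
      then have "R k l * V l i * dist k (x i) \<le> R k l * V l i * (dist k l + dist l (x i))"
        using R(1) V0 by (intro mult_left_mono dist_triangle) auto
      then show "R k l * V l i * dist k (x i) \<le> R k l * V l i * dist k l + R k l * (V l i * dist l (x i))"
        by (simp add: algebra_simps)
    qed
    also have "\<dots> = (\<Sum>k\<in>S. \<Sum>i\<in>I. \<Sum>l\<in>S. R k l * V l i * dist k l)
        + (\<Sum>k\<in>S. \<Sum>i\<in>I. \<Sum>l\<in>S. R k l * (V l i * dist l (x i)))"
      by (simp add: sum.distrib)
    also have "(\<Sum>k\<in>S. \<Sum>i\<in>I. \<Sum>l\<in>S. R k l * (V l i * dist l (x i))) = (\<Sum>k\<in>S. \<Sum>i\<in>I. v k i * dist k (x i))"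
    proof -
      have "(\<Sum>k\<in>S. \<Sum>i\<in>I. \<Sum>l\<in>S. R k l * (V l i * dist l (x i)))
          = (\<Sum>i\<in>I. \<Sum>k\<in>S. \<Sum>l\<in>S. R k l * (V l i * dist l (x i)))" by (rule sum.swap)
      also have "\<dots> = (\<Sum>i\<in>I. \<Sum>k\<in>S. v k i * dist k (x i))" by (rule sum.cong[OF refl]) (rule swap)
      also have "\<dots> = (\<Sum>k\<in>S. \<Sum>i\<in>I. v k i * dist k (x i))" by (rule sum.swap)
      finally show ?thesis .
    qed
    also have "(\<Sum>k\<in>S. \<Sum>i\<in>I. \<Sum>l\<in>S. R k l * V l i * dist k l) = (\<Sum>k\<in>S. \<Sum>l\<in>S. R k l * dist k l)"
    proof (rule sum.cong[OF refl])
      fix k assume "k \<in> S"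
      have "(\<Sum>i\<in>I. \<Sum>l\<in>S. R k l * V l i * dist k l) = (\<Sum>l\<in>S. R k l * (\<Sum>i\<in>I. V l i) * dist k l)"
        by (subst sum.swap) (simp add: sum_distrib_left sum_distrib_right)
      also have "\<dots> = (\<Sum>l\<in>S. R k l * dist k l)"
        using RV[OF \<open>k \<in> S\<close>] by (intro sum.cong) (simp_all only:)
      finally show "(\<Sum>i\<in>I. \<Sum>l\<in>S. R k l * V l i * dist k l) = (\<Sum>l\<in>S. R k l * dist k l)" .
    qed
    \<comment> \<open>Mass that stays in place travels distance 0, so only the off-diagonal part
      pays \<open>D\<close>.\<close>
    also have "\<dots> \<le> (\<Sum>k\<in>S. \<Sum>l\<in>S. (if k = l then 0 else R k l) * D)"
      using R(1) D by (intro sum_mono) (auto intro: mult_left_mono)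
    also have "\<dots> = (\<Sum>k\<in>S. \<Sum>l\<in>S. if k = l then 0 else R k l) * D"
      by (simp only: sum_distrib_right)
    also have "\<dots> \<le> D * (\<Sum>k\<in>S. \<bar>p k - q k\<bar>)"
      using R(4) D(1) by (subst mult.commute) (rule mult_left_mono)
    finally show "(\<Sum>k\<in>S. \<Sum>i\<in>I. T k i * dist k (x i)) \<le>
       D * (\<Sum>k\<in>S. \<bar>p k - (\<Sum>i\<in>I. v k i)\<bar>) + (\<Sum>k\<in>S. \<Sum>i\<in>I. v k i * dist k (x i))"
      by (simp add: q_def)
  qed
qed

text \<open>The three terms are the three legs of a journey: from \<open>y\<close> to an atom,
  between atoms, and from an atom to a sample point. For a random sample, the outer legs have equal
  means, and the middle one measures how far empirical frequencies are from
  \<open>p\<close>.\<close>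

lemma empirical_cost_le_discretization:
  fixes \<mu> :: "'a::polish_space measure" and x :: "nat \<Rightarrow> 'a"
  assumes mu: "\<mu> \<in> prob_measures1" and n: "n \<ge> 1" and fin: "finite S"
    and u: "\<And>k. k \<in> S \<Longrightarrow> u k \<in> borel_measurable borel" "\<And>k y. 0 \<le> u k y" "\<And>y. (\<Sum>k\<in>S. u k y) = 1"
    and p: "\<And>k. k \<in> S \<Longrightarrow> (\<integral>y. u k y \<partial>\<mu>) = p k" "\<And>k. k \<in> S \<Longrightarrow> 0 < p k"
    and D: "0 \<le> D" "\<And>k l. k \<in> S \<Longrightarrow> l \<in> S \<Longrightarrow> dist k l \<le> D"
  shows "empirical_cost \<mu> n x \<le> (\<Sum>k\<in>S. \<integral>y. u k y * dist y k \<partial>\<mu>) +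
    D * (\<Sum>k\<in>S. \<bar>p k - (\<Sum>i=1..n. u k (x i)) / n\<bar>) +
    (\<Sum>i=1..n. \<Sum>k\<in>S. u k (x i) * dist (x i) k) / n"
proof -
  from mu have "prob_space \<mu>" by (auto simp: prob_measures1_def prob_measures_def)
  interpret prob_space \<mu> by fact
  have u_le: "u k y \<le> 1" if "k \<in> S" for k y
    using member_le_sum[of k S "\<lambda>k. u k y"] that fin u by simp
  note int = integrable_weight_dist[OF mu u(1,2) u_le]
  have sum_p: "sum p S = 1"
  proof -
    have "sum p S = (\<Sum>k\<in>S. \<integral>y. u k y \<partial>\<mu>)" using p(1) by simp
    also have "\<dots> = (\<integral>y. (\<Sum>k\<in>S. u k y) \<partial>\<mu>)"
      by (rule Bochner_Integration.integral_sum[symmetric]) (rule int(2))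
    finally show ?thesis by (simp add: u(3) prob_space)
  qed
  \<comment> \<open>Sample point \<open>i\<close>, of mass \<open>1 / n\<close>, is split among the
    atoms by the same \<open>u\<close> that splits \<open>\<mu>\<close>.\<close>
  define v where "v k i = u k (x i) / n" for k i
  have v0: "0 \<le> v k i" for k i by (simp add: v_def u)
  have sum_v: "(\<Sum>k\<in>S. v k i) = 1 / n" for i by (simp add: v_def u(3) flip: sum_divide_distrib)
  have eq: "sum p S = (\<Sum>k\<in>S. \<Sum>i=1..n. v k i)"
    using n by (subst sum.swap) (simp add: sum_v sum_p)
  obtain T where T: "\<forall>k\<in>S. \<forall>i\<in>{1..n}. 0 \<le> T k i" "\<forall>k\<in>S. (\<Sum>i=1..n. T k i) = p k"
    "\<forall>i\<in>{1..n}. (\<Sum>k\<in>S. T k i) = (\<Sum>k\<in>S. v k i)"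
    "(\<Sum>k\<in>S. \<Sum>i=1..n. T k i * dist k (x i)) \<le>
       D * (\<Sum>k\<in>S. \<bar>p k - (\<Sum>i=1..n. v k i)\<bar>) + (\<Sum>k\<in>S. \<Sum>i=1..n. v k i * dist k (x i))"
    using finite_gluing[of S "{1..n}" p v D x, OF fin _ less_imp_le[OF p(2)] v0 eq D] by blast
  \<comment> \<open>Mass at \<open>y\<close> picks the atom \<open>k\<close> with probability
    \<open>u k y\<close> and then the index \<open>i\<close> with probability
    \<open>T k i / p k\<close>; positivity of \<open>p k\<close> makes this well defined.\<close>
  define w where "w i y = (\<Sum>k\<in>S. u k y * (T k i / p k))" for i y
  have w: "w \<in> transport_weights \<mu> n"
    unfolding transport_weights_def
  proof (intro CollectI conjI ballI allI)
    fix i assume i: "i \<in> {1..n}"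
    show "w i \<in> borel_measurable borel"
      unfolding w_def using u(1) by (intro borel_measurable_sum borel_measurable_times) auto
    show "0 \<le> w i y" for y
      unfolding w_def using u(2) p(2) T(1) i by (intro sum_nonneg mult_nonneg_nonneg divide_nonneg_pos) auto
    have "(\<integral>y. w i y \<partial>\<mu>) = (\<Sum>k\<in>S. p k * (T k i / p k))"
      unfolding w_def using int(2) p(1) by (subst Bochner_Integration.integral_sum) simp_all
    also have "\<dots> = (\<Sum>k\<in>S. T k i)"
      using p(2) by (intro sum.cong refl) (simp add: less_imp_neq[symmetric])
    also have "\<dots> = 1 / n" using T(3) i sum_v by simp
    finally show "(\<integral>y. w i y \<partial>\<mu>) = 1 / real n" .
  next
    fix y
    have "(\<Sum>i=1..n. w i y) = (\<Sum>k\<in>S. u k y * ((\<Sum>i=1..n. T k i) / p k))"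
      unfolding w_def by (subst sum.swap) (simp add: sum_distrib_left sum_divide_distrib)
    also have "\<dots> = (\<Sum>k\<in>S. u k y)"
      using p(2) T(2) by (intro sum.cong refl) (simp add: less_imp_neq[symmetric])
    finally show "(\<Sum>i=1..n. w i y) = 1" by (simp add: u(3))
  qed
  have cost_i: "(\<integral>y. w i y * dist y (x i) \<partial>\<mu>) \<le>
      (\<Sum>k\<in>S. (\<integral>y. u k y * dist y k \<partial>\<mu>) * (T k i / p k) + T k i * dist k (x i))" if i: "i \<in> {1..n}" for i
  proof -
    have "(\<integral>y. w i y * dist y (x i) \<partial>\<mu>) = (\<integral>y. (\<Sum>k\<in>S. (u k y * dist y (x i)) * (T k i / p k)) \<partial>\<mu>)"
      unfolding w_def sum_distrib_right by (simp only: ac_simps)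
    also have "\<dots> = (\<Sum>k\<in>S. (\<integral>y. u k y * dist y (x i) \<partial>\<mu>) * (T k i / p k))"
      using int(1) by (subst Bochner_Integration.integral_sum) simp_all
    also have "\<dots> \<le> (\<Sum>k\<in>S. (\<integral>y. u k y * dist y k \<partial>\<mu>) * (T k i / p k) + T k i * dist k (x i))"
    proof (rule sum_mono)
      fix k assume k: "k \<in> S"
      have "(\<integral>y. u k y * dist y (x i) \<partial>\<mu>) \<le> (\<integral>y. u k y * dist y k + u k y * dist k (x i) \<partial>\<mu>)"
      proof (rule integral_mono)
        show "u k y * dist y (x i) \<le> u k y * dist y k + u k y * dist k (x i)" for y
          using u(2) by (simp add: dist_triangle mult_left_mono flip: distrib_left)
      qed (use int k in auto)
      also have "\<dots> = (\<integral>y. u k y * dist y k \<partial>\<mu>) + p k * dist k (x i)"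
        using int k p(1)[OF k] by simp
      finally have "(\<integral>y. u k y * dist y (x i) \<partial>\<mu>) * (T k i / p k) \<le>
          ((\<integral>y. u k y * dist y k \<partial>\<mu>) + p k * dist k (x i)) * (T k i / p k)"
        using T(1) k i p(2)[OF k] by (intro mult_right_mono) auto
      also have "\<dots> = (\<integral>y. u k y * dist y k \<partial>\<mu>) * (T k i / p k) + T k i * dist k (x i)"
        using p(2)[OF k] by (simp add: field_simps)
      finally show "(\<integral>y. u k y * dist y (x i) \<partial>\<mu>) * (T k i / p k) \<le>
          (\<integral>y. u k y * dist y k \<partial>\<mu>) * (T k i / p k) + T k i * dist k (x i)" .
    qed
    finally show ?thesis .
  qed
  have "empirical_cost \<mu> n x \<le> weights_cost \<mu> n x w" by (rule empirical_cost_le[OF w])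
  also have "\<dots> \<le> (\<Sum>i=1..n. \<Sum>k\<in>S. (\<integral>y. u k y * dist y k \<partial>\<mu>) * (T k i / p k) + T k i * dist k (x i))"
    unfolding weights_cost_def by (rule sum_mono) (rule cost_i)
  also have "\<dots> = (\<Sum>k\<in>S. (\<integral>y. u k y * dist y k \<partial>\<mu>) * ((\<Sum>i=1..n. T k i) / p k)) +
      (\<Sum>k\<in>S. \<Sum>i=1..n. T k i * dist k (x i))"
    by (subst sum.swap) (simp add: sum.distrib sum_distrib_left sum_divide_distrib)
  also have "(\<Sum>k\<in>S. (\<integral>y. u k y * dist y k \<partial>\<mu>) * ((\<Sum>i=1..n. T k i) / p k)) = (\<Sum>k\<in>S. \<integral>y. u k y * dist y k \<partial>\<mu>)"
    using T(2) p(2) by (intro sum.cong refl) (simp add: less_imp_neq[symmetric])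
  also have "\<dots> + (\<Sum>k\<in>S. \<Sum>i=1..n. T k i * dist k (x i)) \<le> \<dots> +
       (D * (\<Sum>k\<in>S. \<bar>p k - (\<Sum>i=1..n. v k i)\<bar>) + (\<Sum>k\<in>S. \<Sum>i=1..n. v k i * dist k (x i)))"
    using T(4) by (rule add_left_mono)
  also have "(\<Sum>k\<in>S. \<Sum>i=1..n. v k i * dist k (x i)) = (\<Sum>i=1..n. \<Sum>k\<in>S. u k (x i) * dist (x i) k) / n"
    unfolding v_def by (subst sum.swap) (simp add: sum_divide_distrib dist_commute)
  also have "(\<Sum>k\<in>S. \<bar>p k - (\<Sum>i=1..n. v k i)\<bar>) = (\<Sum>k\<in>S. \<bar>p k - (\<Sum>i=1..n. u k (x i)) / n\<bar>)"
    unfolding v_def by (simp add: sum_divide_distrib)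
  finally show ?thesis by (simp only: add.assoc)
qed

section \<open>Mean deviation of empirical frequencies\<close>

text \<open>This is nonnegativity of the variance of \<open>\<bar>Z\<bar>\<close>.\<close>

lemma (in prob_space) expectation_abs_le_sqrt:
  assumes [measurable]: "Z \<in> borel_measurable M" and B: "\<And>\<omega>. \<bar>Z \<omega>\<bar> \<le> B"
  shows "expectation (\<lambda>\<omega>. \<bar>Z \<omega>\<bar>) \<le> sqrt (expectation (\<lambda>\<omega>. (Z \<omega>)\<^sup>2))"
proof -
  have 1: "integrable M (\<lambda>\<omega>. \<bar>Z \<omega>\<bar>)" by (rule integrable_const_bound[where B=B]) (use B in auto)
  have 2: "integrable M (\<lambda>\<omega>. (Z \<omega>)\<^sup>2)"
    by (rule integrable_const_bound[where B="B\<^sup>2"]) (use B in \<open>auto simp: abs_le_square_iff[symmetric] intro: order_trans[OF _ abs_ge_self]\<close>)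
  have "0 \<le> variance (\<lambda>\<omega>. \<bar>Z \<omega>\<bar>)" by (rule variance_positive)
  also have "\<dots> = expectation (\<lambda>\<omega>. (Z \<omega>)\<^sup>2) - (expectation (\<lambda>\<omega>. \<bar>Z \<omega>\<bar>))\<^sup>2"
    using variance_eq[OF 1] 2 by simp
  finally show ?thesis by (intro real_le_rsqrt) simp
qed

text \<open>Independence removes the mixed terms, and \<open>h\<^sup>2 \<le> h\<close> bounds each
  variance by \<open>p\<close>. \<open>h\<close> ranges over \<open>[0, 1]\<close> rather than being
  an indicator because the discretization is randomized. Keeping \<open>p\<close> in the bound is
  what lets the sum over the atoms be controlled later by their total mass 1.\<close>

lemma (in prob_space) expectation_abs_empirical_deviation:
  fixes X :: "nat \<Rightarrow> 'a \<Rightarrow> 'c" and h :: "'c \<Rightarrow> real"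
  assumes ind: "indep_vars (\<lambda>_. N) X {1..n}" and n: "n \<ge> 1"
    and law: "\<And>i. i \<in> {1..n} \<Longrightarrow> distr M N (X i) = \<mu>"
    and h[measurable]: "h \<in> borel_measurable N" and h01: "\<And>y. 0 \<le> h y" "\<And>y. h y \<le> 1"
    and p: "(\<integral>y. h y \<partial>\<mu>) = p"
  shows "expectation (\<lambda>\<omega>. \<bar>p - (\<Sum>i=1..n. h (X i \<omega>)) / n\<bar>) \<le> sqrt (p / n)"
proof -
  have rv[measurable]: "X i \<in> M \<rightarrow>\<^sub>M N" if "i \<in> {1..n}" for i
    using ind that by (auto simp: indep_vars_def)
  define Y where "Y i \<omega> = h (X i \<omega>) - p" for i \<omega>
  have Ym[measurable]: "Y i \<in> borel_measurable M" if "i \<in> {1..n}" for i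
    unfolding Y_def using rv[OF that] by measurable
  have ih: "integrable M (\<lambda>\<omega>. h (X i \<omega>))" if "i \<in> {1..n}" for i
    by (rule integrable_const_bound[where B=1]) (use h01 rv[OF that] in auto)
  have Eh: "expectation (\<lambda>\<omega>. h (X i \<omega>)) = p" if "i \<in> {1..n}" for i
    unfolding p[symmetric] law[OF that, symmetric] using rv[OF that] by (simp add: integral_distr)
  have p01: "0 \<le> p" "p \<le> 1"
  proof -
    have 1: "1 \<in> {1..n}" using n by simp
    show "0 \<le> p" unfolding p[symmetric] by (rule Bochner_Integration.integral_nonneg) (rule h01)
    have "p \<le> expectation (\<lambda>_. 1)"
      unfolding Eh[OF 1, symmetric] by (rule integral_mono) (use ih[OF 1] h01 in auto)
    then show "p \<le> 1" by (simp add: prob_space)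
  qed
  have YB: "\<bar>Y i \<omega>\<bar> \<le> 1" for i \<omega>
    using h01[of "X i \<omega>"] p01 by (auto simp: Y_def)
  have iY: "integrable M (Y i)" if "i \<in> {1..n}" for i
    by (rule integrable_const_bound[where B=1]) (use YB Ym[OF that] in auto)
  have EY: "expectation (Y i) = 0" if "i \<in> {1..n}" for i
    unfolding Y_def using ih[OF that] Eh[OF that] by (simp add: prob_space)
  have iYY: "integrable M (\<lambda>\<omega>. Y i \<omega> * Y j \<omega>)" if "i \<in> {1..n}" "j \<in> {1..n}" for i j
    by (rule integrable_const_bound[where B=1])
       (use YB Ym[OF that(1)] Ym[OF that(2)] in \<open>auto simp: abs_mult mult_le_one\<close>)
  have indY: "indep_vars (\<lambda>_. borel) Y {1..n}"
    unfolding Y_def by (rule indep_vars_compose2[OF ind, of "\<lambda>_ y. h y - p"]) measurable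
  have EYY: "expectation (\<lambda>\<omega>. Y i \<omega> * Y j \<omega>) \<le> (if i = j then p else 0)"
    if i: "i \<in> {1..n}" and j: "j \<in> {1..n}" for i j
  proof (cases "i = j")
    case True
    have ihh: "integrable M (\<lambda>\<omega>. h (X i \<omega>) * h (X i \<omega>))"
      by (rule integrable_const_bound[where B=1]) (use h01 rv[OF i] in \<open>auto simp: abs_mult mult_le_one\<close>)
    have "Y i \<omega> * Y i \<omega> = h (X i \<omega>) * h (X i \<omega>) - 2 * p * h (X i \<omega>) + p * p" for \<omega>
      by (simp add: Y_def algebra_simps)
    then have "expectation (\<lambda>\<omega>. Y i \<omega> * Y i \<omega>) = expectation (\<lambda>\<omega>. h (X i \<omega>) * h (X i \<omega>)) - p * p"
      using ihh ih[OF i] Eh[OF i] by (simp add: prob_space)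
    also have "\<dots> \<le> expectation (\<lambda>\<omega>. h (X i \<omega>) * h (X i \<omega>))" by simp
    also have "\<dots> \<le> expectation (\<lambda>\<omega>. h (X i \<omega>))"
      by (rule integral_mono[OF ihh ih[OF i]]) (use h01 in \<open>simp add: mult_left_le\<close>)
    finally show ?thesis using True Eh[OF i] by simp
  next
    case False
    have "expectation (\<lambda>\<omega>. \<Prod>k\<in>{i, j}. Y k \<omega>) = (\<Prod>k\<in>{i, j}. expectation (Y k))"
      by (rule indep_vars_lebesgue_integral) (use i j iY indep_vars_subset[OF indY] in auto)
    then show ?thesis using False EY[OF i] by simp
  qed
  define Z where "Z \<omega> = (\<Sum>i=1..n. Y i \<omega>)" for \<omega>
  have Zm[measurable]: "Z \<in> borel_measurable M"
    unfolding Z_def using Ym by (intro borel_measurable_sum) auto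
  have ZB: "\<bar>Z \<omega>\<bar> \<le> n" for \<omega>
  proof -
    have "\<bar>Z \<omega>\<bar> \<le> (\<Sum>i=1..n. \<bar>Y i \<omega>\<bar>)" unfolding Z_def by (rule sum_abs)
    also have "\<dots> \<le> (\<Sum>i=1..n. 1)" by (rule sum_mono) (rule YB)
    finally show ?thesis by simp
  qed
  have "expectation (\<lambda>\<omega>. (Z \<omega>)\<^sup>2) = expectation (\<lambda>\<omega>. \<Sum>i=1..n. \<Sum>j=1..n. Y i \<omega> * Y j \<omega>)"
    by (simp add: Z_def power2_eq_square sum_product)
  also have "\<dots> = (\<Sum>i=1..n. \<Sum>j=1..n. expectation (\<lambda>\<omega>. Y i \<omega> * Y j \<omega>))"
    using iYY by (subst Bochner_Integration.integral_sum, force)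
      (intro sum.cong refl Bochner_Integration.integral_sum, blast)
  also have "\<dots> \<le> (\<Sum>i=1..n. \<Sum>j=1..n. if i = j then p else 0)"
    by (intro sum_mono EYY)
  also have "\<dots> = n * p" by simp
  finally have EZ: "expectation (\<lambda>\<omega>. (Z \<omega>)\<^sup>2) \<le> n * p" .
  have "p - (\<Sum>i=1..n. h (X i \<omega>)) / n = - (Z \<omega> / n)" for \<omega>
    using n by (simp add: Z_def Y_def sum_subtractf field_simps)
  then have "expectation (\<lambda>\<omega>. \<bar>p - (\<Sum>i=1..n. h (X i \<omega>)) / n\<bar>) = expectation (\<lambda>\<omega>. \<bar>Z \<omega>\<bar>) / n"
    by simp
  also have "\<dots> \<le> sqrt (n * p) / n"
    using expectation_abs_le_sqrt[OF Zm ZB] EZ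
    by (intro divide_right_mono) (auto intro: order_trans real_sqrt_le_mono)
  also have "\<dots> = sqrt (p / n)"
    using n by (simp add: real_sqrt_mult real_sqrt_divide real_div_sqrt field_simps)
  finally show ?thesis .
qed

section \<open>Finitely supported approximations\<close>

text \<open>The complement of the support is a union of open null sets; by the Lindelof property
  countably many of them cover it.\<close>

lemma AE_Supp:
  fixes \<nu> :: "'a::polish_space measure"
  assumes "\<nu> \<in> prob_measures"
  shows "AE y in \<nu>. y \<in> Supp \<nu>"
proof -
  from assms have s: "sets \<nu> = sets borel" by (simp add: prob_measures_def)
  define \<F> where "\<F> = {U. open U \<and> emeasure \<nu> U = 0}"
  obtain \<F>' where F: "\<F>' \<subseteq> \<F>" "countable \<F>'" "\<Union>\<F>' = \<Union>\<F>"
    by (rule Lindelof[of \<F>]) (auto simp: \<F>_def)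
  have "U \<in> null_sets \<nu>" if "U \<in> \<F>'" for U
    using that F(1) by (auto simp: \<F>_def null_sets_def s)
  with F(2) have "\<Union>\<F>' \<in> null_sets \<nu>" by (rule null_sets_UN'[of \<F>' "\<lambda>U. U", simplified])
  then show ?thesis
  proof (rule AE_I')
    have "- Supp \<nu> \<subseteq> \<Union>\<F>" by (auto simp: Supp_def \<F>_def zero_less_iff_neq_zero)
    then show "{y \<in> space \<nu>. y \<notin> Supp \<nu>} \<subseteq> \<Union>\<F>'" using F(3) by auto
  qed
qed

text \<open>Deleting the finitely many other support points leaves an open neighbourhood of
  \<open>k\<close>, which has positive mass and agrees with \<open>{k}\<close> almost
  everywhere.\<close>

lemma measure_atom_pos:
  fixes \<nu> :: "'a::polish_space measure"
  assumes nu: "\<nu> \<in> prob_measures" and fin: "finite (Supp \<nu>)" and k: "k \<in> Supp \<nu>"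
  shows "0 < measure \<nu> {k}"
proof -
  from nu have s: "sets \<nu> = sets borel" and "prob_space \<nu>" by (auto simp: prob_measures_def)
  interpret prob_space \<nu> by fact
  have op: "open (- (Supp \<nu> - {k}))" using fin by (intro open_Compl finite_imp_closed) simp
  then have "emeasure \<nu> (- (Supp \<nu> - {k})) > 0" using k unfolding Supp_def by blast
  also have "emeasure \<nu> (- (Supp \<nu> - {k})) = emeasure \<nu> {k}"
    by (rule emeasure_eq_AE) (use AE_Supp[OF nu] k op in \<open>auto simp: s\<close>)
  finally show ?thesis by (simp add: emeasure_eq_measure)
qed

text \<open>Guarantees that the real infimum in \<open>K_const\<close> runs over a nonempty set.
  Simple functions \<open>F i\<close> converge pointwise to the identity and stay within
  \<open>3 * dist x0 x\<close> of it, so dominated convergence makes the cost of the coupling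
  \<open>(x, F i x)\<close> small.\<close>

lemma exists_finite_support_W1_le:
  fixes \<mu> :: "'a::polish_space measure"
  assumes mu: "\<mu> \<in> prob_measures1" and e: "0 < e"
  obtains \<nu> where "\<nu> \<in> prob_measures" "finite (Supp \<nu>)" "W1 \<mu> \<nu> \<le> ennreal e"
proof -
  from mu obtain x0 where x0: "integrable \<mu> (\<lambda>x. dist x0 x)"
    and s[measurable_cong]: "sets \<mu> = sets borel" and "prob_space \<mu>" and mup: "\<mu> \<in> prob_measures"
    by (auto simp: prob_measures1_def prob_measures_def)
  interpret prob_space \<mu> by fact
  have sp: "space \<mu> = UNIV" using sets_eq_imp_space_eq[OF s] by simp
  have "(\<lambda>x. x) \<in> borel_measurable \<mu>" by measurable
  from borel_measurable_implies_sequence_metric[OF this, of x0] obtain F where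
    F: "\<And>i. simple_function \<mu> (F i)" "\<And>x. (\<lambda>i. F i x) \<longlonglongrightarrow> x" "\<And>i x. dist (F i x) x0 \<le> 2 * dist x x0"
    by (auto simp: sp)
  have [measurable]: "F i \<in> \<mu> \<rightarrow>\<^sub>M borel" for i
    using F(1) by (rule borel_measurable_simple_function)
  have F_dist: "dist x (F i x) \<le> 3 * dist x0 x" for i x
    using dist_triangle2[of x "F i x" x0] F(3)[of i x] by (simp add: dist_commute)
  have "(\<lambda>i. \<integral>x. dist x (F i x) \<partial>\<mu>) \<longlonglongrightarrow> (\<integral>x. 0 \<partial>\<mu>)"
  proof (rule integral_dominated_convergence[where w="\<lambda>x. 3 * dist x0 x"])
    show "AE x in \<mu>. (\<lambda>i. dist x (F i x)) \<longlonglongrightarrow> 0"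
    proof (rule AE_I2)
      fix x
      have "(\<lambda>i. dist x (F i x)) \<longlonglongrightarrow> dist x x" by (intro tendsto_dist tendsto_const F(2))
      then show "(\<lambda>i. dist x (F i x)) \<longlonglongrightarrow> 0" by simp
    qed
    show "AE x in \<mu>. norm (dist x (F i x)) \<le> 3 * dist x0 x" for i
      using F_dist by simp
  qed (use x0 in auto)
  then have "\<forall>\<^sub>F i in sequentially. (\<integral>x. dist x (F i x) \<partial>\<mu>) < e"
    using e by (intro order_tendstoD) simp_all
  then obtain i where i: "(\<integral>x. dist x (F i x) \<partial>\<mu>) < e" by (auto simp: eventually_sequentially)
  define \<nu> where "\<nu> = distr \<mu> borel (F i)"
  have finF: "finite (range (F i))" using F(1)[of i] by (simp add: simple_function_def sp)
  show thesis
  proof (rule that[of \<nu>])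
    show "\<nu> \<in> prob_measures" by (simp add: \<nu>_def prob_measures_def prob_space_distr)
    have "Supp \<nu> \<subseteq> range (F i)"
    proof
      fix x assume x: "x \<in> Supp \<nu>"
      show "x \<in> range (F i)"
      proof (rule ccontr)
        assume "x \<notin> range (F i)"
        moreover have op: "open (- range (F i))" using finF by (intro open_Compl finite_imp_closed)
        ultimately have "emeasure \<nu> (- range (F i)) > 0" using x unfolding Supp_def by blast
        moreover have "emeasure \<nu> (- range (F i)) = emeasure \<mu> {}"
        proof -
          have "F i -` (- range (F i)) = {}" by auto
          then show ?thesis unfolding \<nu>_def using op by (subst emeasure_distr) simp_all
        qed
        ultimately show False by simp
      qed
    qed
    then show "finite (Supp \<nu>)" using finF by (rule finite_subset)
    define \<pi> where "\<pi> = distr \<mu> (borel \<Otimes>\<^sub>M borel) (\<lambda>x. (x, F i x))"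
    have "distr \<pi> borel fst = \<mu>"
      unfolding \<pi>_def by (subst distr_distr) (simp_all add: comp_def distr_id2 s)
    moreover have "distr \<pi> borel snd = \<nu>"
      unfolding \<pi>_def \<nu>_def by (subst distr_distr) (simp_all add: comp_def)
    moreover have "prob_space \<pi>" unfolding \<pi>_def by (rule prob_space_distr) measurable
    ultimately have "\<pi> \<in> couplings \<mu> \<nu>" by (simp add: couplings_def \<pi>_def)
    then have "W1 \<mu> \<nu> \<le> (\<integral>\<^sup>+ z. ennreal (dist (fst z) (snd z)) \<partial>\<pi>)"
      unfolding W1_def by (rule INF_lower)
    also have "\<dots> = (\<integral>\<^sup>+ x. ennreal (dist x (F i x)) \<partial>\<mu>)"
      unfolding \<pi>_def by (subst nn_integral_distr) simp_all
    also have "\<dots> = ennreal (\<integral>x. dist x (F i x) \<partial>\<mu>)"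
    proof (rule nn_integral_eq_integral)
      show "integrable \<mu> (\<lambda>x. dist x (F i x))"
      proof (rule Bochner_Integration.integrable_bound)
        show "integrable \<mu> (\<lambda>x. 3 * dist x0 x)" using x0 by simp
        show "AE x in \<mu>. norm (dist x (F i x)) \<le> norm (3 * dist x0 x)"
          using F_dist by simp
      qed measurable
    qed simp
    also have "\<dots> \<le> ennreal e" using i by (intro ennreal_leI) simp
    finally show "W1 \<mu> \<nu> \<le> ennreal e" .
  qed
qed

section \<open>Concentration of the transport cost\<close>

lemma (in prob_space) exponential_moment_indep:
  fixes X :: "nat \<Rightarrow> 'a \<Rightarrow> 'e::polish_space" and F :: "(nat \<Rightarrow> 'e) \<Rightarrow> real"
  assumes "C > 0" and T1: "T1 C \<mu>" and n: "n \<ge> 1"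
    and ind: "indep_vars (\<lambda>_. borel) X {1..n}"
    and law: "\<And>i. i \<in> {1..n} \<Longrightarrow> distr M borel (X i) = \<mu>"
    and "L \<ge> 0" and B: "\<And>x. \<bar>F x\<bar> \<le> B"
    and L: "\<And>x y. \<bar>F x - F y\<bar> \<le> L * (\<Sum>i=1..n. dist (x i) (y i))"
  shows "(\<lambda>\<omega>. F (\<lambda>i. X i \<omega>)) \<in> borel_measurable M"
    and "expectation (\<lambda>\<omega>. exp (F (\<lambda>i. X i \<omega>))) \<le> exp (expectation (\<lambda>\<omega>. F (\<lambda>i. X i \<omega>)) + n * (L\<^sup>2 * C / 4))"
proof -
  from T1 have mu: "prob_space \<mu>" "sets \<mu> = sets borel"
    by (auto simp: T1_def prob_measures1_def prob_measures_def)
  define P where "P = PiM {1..n} (\<lambda>_. \<mu>)"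
  define XI where "XI \<omega> = (\<lambda>i\<in>{1..n}. X i \<omega>)" for \<omega>
  have rv: "X i \<in> M \<rightarrow>\<^sub>M borel" if "i \<in> {1..n}" for i
    using ind that by (auto simp: indep_vars_def)
  have XI[measurable]: "XI \<in> M \<rightarrow>\<^sub>M PiM {1..n} (\<lambda>_. borel)"
    unfolding XI_def by (rule measurable_restrict) (rule rv)
  have "distr M (PiM {1..n} (\<lambda>_. borel)) XI = PiM {1..n} (\<lambda>i. distr M borel (X i))"
    unfolding XI_def by (rule indep_vars_iff_distr_eq_PiM'[THEN iffD1]) (use n rv ind in auto)
  also have "\<dots> = P" unfolding P_def by (rule PiM_cong) (simp_all add: law)
  finally have dP: "distr M (PiM {1..n} (\<lambda>_. borel)) XI = P" .
  \<comment> \<open>\<open>XI\<close> is cut off to \<open>undefined\<close> outside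
    \<open>{1..n}\<close>, whereas \<open>F\<close> sees only the coordinates inside: the Lipschitz
    bound between the two arguments is 0.\<close>
  have FX: "F (XI \<omega>) = F (\<lambda>i. X i \<omega>)" for \<omega>
    using L[of "XI \<omega>" "\<lambda>i. X i \<omega>"] by (simp add: XI_def)
  have Fm[measurable]: "F \<in> borel_measurable (PiM {1..n} (\<lambda>_. borel))"
    by (rule borel_measurable_PiM_Lipschitz[OF _ L]) simp
  have "(\<lambda>\<omega>. F (XI \<omega>)) \<in> borel_measurable M" by measurable
  then show "(\<lambda>\<omega>. F (\<lambda>i. X i \<omega>)) \<in> borel_measurable M" by (simp add: FX)
  have "(\<integral>x. exp (F x) \<partial>P) \<le> exp ((\<integral>x. F x \<partial>P) + real (card {1..n}) * (L\<^sup>2 * C / 4))"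
    unfolding P_def
  proof (rule exponential_moment_PiM[OF mu _ _ \<open>L \<ge> 0\<close> B L])
    fix f :: "'e \<Rightarrow> real" and B
    assume "f \<in> borel_measurable borel" "\<And>x. \<bar>f x\<bar> \<le> B" "\<And>x y. \<bar>f x - f y\<bar> \<le> L * dist x y"
    then show "(\<integral>x. exp (f x) \<partial>\<mu>) \<le> exp ((\<integral>x. f x \<partial>\<mu>) + L\<^sup>2 * C / 4)"
      by (rule T1_imp_exponential_moment[OF \<open>C > 0\<close> T1 _ _ \<open>L \<ge> 0\<close>])
  qed simp
  then show "expectation (\<lambda>\<omega>. exp (F (\<lambda>i. X i \<omega>))) \<le> exp (expectation (\<lambda>\<omega>. F (\<lambda>i. X i \<omega>)) + n * (L\<^sup>2 * C / 4))"
    using integral_distr[OF XI Fm] integral_distr[OF XI, of "\<lambda>x. exp (F x)"] Fm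
    unfolding dP by (simp add: FX)
qed

text \<open>Chernoff's bound for the cost truncated at \<open>t\<close>. Truncation provides the
  boundedness required by the exponential moment estimate and preserves the Lipschitz constant
  \<open>1 / n\<close>.\<close>

lemma (in prob_space) empirical_cost_tail:
  fixes X :: "nat \<Rightarrow> 'a \<Rightarrow> 'e::polish_space"
  assumes C: "C > 0" and T1: "T1 C \<mu>" and n: "n \<ge> 1" and t: "t > 0"
    and ind: "indep_vars (\<lambda>_. borel) X {1..n}"
    and law: "\<And>i. i \<in> {1..n} \<Longrightarrow> distr M borel (X i) = \<mu>"
  defines "F \<equiv> \<lambda>\<omega>. min (empirical_cost \<mu> n (\<lambda>i. X i \<omega>)) t"
  shows "F \<in> borel_measurable M" and "expectation F \<le> t"
    and "prob {\<omega> \<in> space M. t \<le> F \<omega>} \<le> exp (- (n * (t - expectation F)\<^sup>2 / C))"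
proof -
  from T1 have mu1: "\<mu> \<in> prob_measures1" and mu: "prob_space \<mu>"
    by (auto simp: T1_def prob_measures1_def prob_measures_def)
  define G where "G x = min (empirical_cost \<mu> n x) t" for x
  have F_G: "F \<omega> = G (\<lambda>i. X i \<omega>)" for \<omega> by (simp add: F_def G_def)
  have G0: "0 \<le> G x" "G x \<le> t" for x
    using empirical_cost_nonneg[OF mu n, of x] t by (auto simp: G_def)
  have GL: "\<bar>G x - G y\<bar> \<le> 1 / n * (\<Sum>i=1..n. dist (x i) (y i))" for x y
    using empirical_cost_Lipschitz[OF mu1 n, of x y] by (auto simp: G_def min_def abs_if split: if_splits)
  have GB: "\<bar>G x\<bar> \<le> t" for x using G0[of x] by simp
  show Fm[measurable]: "F \<in> borel_measurable M"
    unfolding F_G[abs_def]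
    by (rule exponential_moment_indep(1)[OF C T1 n ind law _ GB GL]) simp_all
  have F_le: "F \<omega> \<le> t" for \<omega> by (simp add: F_def)
  have iF: "integrable M F"
    by (rule integrable_const_bound[where B=t]) (use GB in \<open>auto simp: F_G\<close>)
  have "expectation F \<le> expectation (\<lambda>_. t)"
    by (rule integral_mono[OF iF]) (use G0 in \<open>auto simp: F_G\<close>)
  then show e: "expectation F \<le> t" by (simp add: prob_space)
  \<comment> \<open>The minimizer of
    \<open>l\<^sup>2 * C / (4 * n) - l * (t - expectation F)\<close>; it is nonnegative because the
    truncated mean is at most \<open>t\<close>.\<close>
  define l where "l = 2 * n * (t - expectation F) / C"
  have l0: "0 \<le> l" using e C by (simp add: l_def)
  have "expectation (\<lambda>\<omega>. exp (l * G (\<lambda>i. X i \<omega>))) \<le>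
      exp (expectation (\<lambda>\<omega>. l * G (\<lambda>i. X i \<omega>)) + n * ((l / n)\<^sup>2 * C / 4))"
  proof (rule exponential_moment_indep(2)[OF C T1 n ind law])
    show "0 \<le> l / n" using l0 by simp
    show "\<bar>l * G x\<bar> \<le> l * t" for x using GB[of x] l0 by (simp add: abs_mult mult_left_mono)
    show "\<bar>l * G x - l * G y\<bar> \<le> l / n * (\<Sum>i=1..n. dist (x i) (y i))" for x y
      using mult_left_mono[OF GL[of x y] l0] l0 by (simp add: abs_mult flip: right_diff_distrib)
  qed simp
  then have mgf: "expectation (\<lambda>\<omega>. exp (l * F \<omega>)) \<le> exp (l * expectation F + l\<^sup>2 * C / (4 * n))"
    unfolding F_G[abs_def] using n by (simp add: power2_eq_square field_simps)
  have iE: "integrable M (\<lambda>\<omega>. exp (l * F \<omega>))"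
    by (rule integrable_const_bound[where B="exp (l * t)"])
       (simp_all add: F_le l0 mult_left_mono)
  have "prob {\<omega> \<in> space M. t \<le> F \<omega>} \<le> prob {\<omega> \<in> space M. exp (l * t) \<le> exp (l * F \<omega>)}"
  proof (rule finite_measure_mono)
    show "{\<omega> \<in> space M. t \<le> F \<omega>} \<subseteq> {\<omega> \<in> space M. exp (l * t) \<le> exp (l * F \<omega>)}"
      using mult_left_mono[OF _ l0] by auto
  qed measurable
  also have "\<dots> \<le> expectation (\<lambda>\<omega>. exp (l * F \<omega>)) / exp (l * t)"
    by (rule integral_Markov_inequality_measure[where A="{}"]) (use iE in auto)
  also have "\<dots> \<le> exp (l * expectation F + l\<^sup>2 * C / (4 * n)) / exp (l * t)"
    using mgf by (intro divide_right_mono) simp_all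
  also have "\<dots> = exp (l * expectation F + l\<^sup>2 * C / (4 * n) - l * t)" by (simp add: exp_diff)
  also have "l * expectation F + l\<^sup>2 * C / (4 * n) - l * t = - (n * (t - expectation F)\<^sup>2 / C)"
  proof -
    have "l\<^sup>2 * C / (4 * n) = n * (t - expectation F)\<^sup>2 / C"
      using C n by (simp add: l_def power2_eq_square)
    moreover have "l * (t - expectation F) = 2 * (n * (t - expectation F)\<^sup>2 / C)"
      by (simp add: l_def power2_eq_square)
    ultimately show ?thesis by (simp add: right_diff_distrib)
  qed
  finally show "prob {\<omega> \<in> space M. t \<le> F \<omega>} \<le> exp (- (n * (t - expectation F)\<^sup>2 / C))" .
qed

text \<open>The factor 2 arises because the discretization cost \<open>A\<close>, at most
  \<open>c\<close>, occurs once for \<open>\<mu>\<close> and once as the mean over the sample.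
  \<open>F\<close> is only assumed to lie below the cost, so that the truncated cost can be
  inserted.\<close>

lemma (in prob_space) expectation_empirical_cost_le:
  fixes X :: "nat \<Rightarrow> 'a \<Rightarrow> 'e::polish_space"
  assumes mu1: "\<mu> \<in> prob_measures1" and n: "n \<ge> 1"
    and ind: "indep_vars (\<lambda>_. borel) X {1..n}"
    and law: "\<And>i. i \<in> {1..n} \<Longrightarrow> distr M borel (X i) = \<mu>"
    and nu: "\<nu> \<in> prob_measures" and fin: "finite (Supp \<nu>)" and pi: "\<pi> \<in> couplings \<mu> \<nu>"
    and cost: "(\<integral>\<^sup>+ z. ennreal (dist (fst z) (snd z)) \<partial>\<pi>) \<le> ennreal c" and "0 \<le> c"
    and F: "integrable M F" "\<And>\<omega>. F \<omega> \<le> empirical_cost \<mu> n (\<lambda>i. X i \<omega>)"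
  shows "expectation F \<le> 2 * c + diameter (Supp \<nu>) * sqrt (card (Supp \<nu>) / n)"
proof -
  define S where "S = Supp \<nu>"
  from mu1 have mu: "\<mu> \<in> prob_measures" and s: "sets \<mu> = sets borel"
    by (auto simp: prob_measures1_def prob_measures_def)
  from mu have prob_mu: "prob_space \<mu>" by (simp add: prob_measures_def)
  have finS: "finite S" using fin by (simp add: S_def)
  obtain u where u: "\<And>k. k \<in> S \<Longrightarrow> u k \<in> borel_measurable borel" "\<And>k y. 0 \<le> u k y"
    "\<And>y. (\<Sum>k\<in>S. u k y) = 1" "\<And>k. k \<in> S \<Longrightarrow> (\<integral>y. u k y \<partial>\<mu>) = measure \<nu> {k}"
    "(\<Sum>k\<in>S. \<integral>\<^sup>+ y. ennreal (u k y * dist y k) \<partial>\<mu>) \<le> (\<integral>\<^sup>+ z. ennreal (dist (fst z) (snd z)) \<partial>\<pi>)"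
    using finite_coupling_disintegration[OF mu pi finS AE_Supp[OF nu, folded S_def]] by blast
  define p where "p k = measure \<nu> {k}" for k
  have p: "0 < p k" if "k \<in> S" for k
    unfolding p_def using measure_atom_pos[OF nu fin] that by (simp add: S_def)
  define D where "D = diameter S"
  have D: "0 \<le> D" "\<And>k l. k \<in> S \<Longrightarrow> l \<in> S \<Longrightarrow> dist k l \<le> D"
    using finite_imp_bounded[OF finS] by (auto simp: D_def diameter_ge_0 diameter_bounded_bound)
  have u_le: "u k y \<le> 1" if "k \<in> S" for k y
    using member_le_sum[of k S "\<lambda>k. u k y"] that finS u by simp
  note int = integrable_weight_dist[OF mu1 u(1,2) u_le]
  have sum_p: "sum p S = 1"
  proof -
    have "sum p S = (\<Sum>k\<in>S. \<integral>y. u k y \<partial>\<mu>)" using u(4) by (simp add: p_def)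
    also have "\<dots> = (\<integral>y. (\<Sum>k\<in>S. u k y) \<partial>\<mu>)"
      by (rule Bochner_Integration.integral_sum[symmetric]) (rule int(2))
    finally show ?thesis using prob_mu by (simp add: u(3) prob_space.prob_space)
  qed
  define A where "A = (\<Sum>k\<in>S. \<integral>y. u k y * dist y k \<partial>\<mu>)"
  have "ennreal A = (\<Sum>k\<in>S. \<integral>\<^sup>+ y. ennreal (u k y * dist y k) \<partial>\<mu>)"
    unfolding A_def using int(1) u(2)
    by (subst sum_ennreal[symmetric]) (simp_all add: nn_integral_eq_integral)
  also have "\<dots> \<le> ennreal c" using u(5) cost by (rule order_trans)
  finally have A: "A \<le> c" using \<open>0 \<le> c\<close> by simp
  have rv: "X i \<in> M \<rightarrow>\<^sub>M borel" if "i \<in> {1..n}" for i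
    using ind that by (auto simp: indep_vars_def)
  have int_c: "integrable M (\<lambda>\<omega>. u k (X i \<omega>) * dist (X i \<omega>) k)"
    and E_c: "expectation (\<lambda>\<omega>. u k (X i \<omega>) * dist (X i \<omega>) k) = (\<integral>y. u k y * dist y k \<partial>\<mu>)"
    if "k \<in> S" "i \<in> {1..n}" for k i
  proof -
    have m: "(\<lambda>y. u k y * dist y k) \<in> borel_measurable borel"
      using u(1)[OF that(1)] by measurable
    show "integrable M (\<lambda>\<omega>. u k (X i \<omega>) * dist (X i \<omega>) k)"
      using int(1)[OF that(1,1), of k] integrable_distr_eq[OF rv[OF that(2)] m] law[OF that(2)] by simp
    show "expectation (\<lambda>\<omega>. u k (X i \<omega>) * dist (X i \<omega>) k) = (\<integral>y. u k y * dist y k \<partial>\<mu>)"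
      using integral_distr[OF rv[OF that(2)] m] law[OF that(2)] by simp
  qed
  have int_d: "integrable M (\<lambda>\<omega>. \<bar>p k - (\<Sum>i=1..n. u k (X i \<omega>)) / n\<bar>)" if k: "k \<in> S" for k
  proof -
    have "integrable M (\<lambda>\<omega>. u k (X i \<omega>))" if i: "i \<in> {1..n}" for i
      using int(2)[OF k k] integrable_distr_eq[OF rv[OF i] u(1)[OF k]] law[OF i] by simp
    then show ?thesis by (intro integrable_abs Bochner_Integration.integrable_diff
        Bochner_Integration.integrable_divide Bochner_Integration.integrable_sum) auto
  qed
  have E_d: "expectation (\<lambda>\<omega>. \<bar>p k - (\<Sum>i=1..n. u k (X i \<omega>)) / n\<bar>) \<le> sqrt (p k / n)" if k: "k \<in> S" for k
    by (rule expectation_abs_empirical_deviation[OF ind n law])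
       (use u k u_le in \<open>auto simp: p_def\<close>)
  define d where "d \<omega> = (\<Sum>k\<in>S. \<bar>p k - (\<Sum>i=1..n. u k (X i \<omega>)) / n\<bar>)" for \<omega>
  have d: "integrable M d"
    "expectation d = (\<Sum>k\<in>S. expectation (\<lambda>\<omega>. \<bar>p k - (\<Sum>i=1..n. u k (X i \<omega>)) / n\<bar>))"
    unfolding d_def
    by (rule Bochner_Integration.integrable_sum[OF int_d] Bochner_Integration.integral_sum[OF int_d]; assumption)+
  define r where "r \<omega> = (\<Sum>i=1..n. \<Sum>k\<in>S. u k (X i \<omega>) * dist (X i \<omega>) k)" for \<omega>
  have r_int: "integrable M r"
    unfolding r_def by (intro Bochner_Integration.integrable_sum int_c)
  have "expectation r = (\<Sum>i=1..n. expectation (\<lambda>\<omega>. \<Sum>k\<in>S. u k (X i \<omega>) * dist (X i \<omega>) k))"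
    unfolding r_def by (rule Bochner_Integration.integral_sum) (intro Bochner_Integration.integrable_sum int_c)
  also have "\<dots> = (\<Sum>i=1..n. A)"
  proof (rule sum.cong[OF refl])
    fix i assume i: "i \<in> {1..n}"
    have "expectation (\<lambda>\<omega>. \<Sum>k\<in>S. u k (X i \<omega>) * dist (X i \<omega>) k) =
        (\<Sum>k\<in>S. expectation (\<lambda>\<omega>. u k (X i \<omega>) * dist (X i \<omega>) k))"
      by (rule Bochner_Integration.integral_sum) (rule int_c[OF _ i])
    also have "\<dots> = A" unfolding A_def by (rule sum.cong[OF refl]) (rule E_c[OF _ i])
    finally show "expectation (\<lambda>\<omega>. \<Sum>k\<in>S. u k (X i \<omega>) * dist (X i \<omega>) k) = A" .
  qed
  finally have r: "expectation r / n = A" using n by simp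
  have "expectation F \<le> expectation (\<lambda>\<omega>. A + D * d \<omega> + r \<omega> / n)"
  proof (rule integral_mono[OF F(1)])
    show "F \<omega> \<le> A + D * d \<omega> + r \<omega> / n" for \<omega>
      unfolding A_def d_def r_def
      by (rule order_trans[OF F(2)], rule empirical_cost_le_discretization[OF mu1 n finS u(1-3) _ p D])
         (simp_all add: u(4) p_def)
  qed (use d(1) r_int in simp)
  also have "\<dots> = A + D * expectation d + A"
    using d(1) r_int r by (simp add: prob_space)
  also have "\<dots> \<le> A + D * sqrt (card S / n) + A"
  proof -
    have "expectation d \<le> (\<Sum>k\<in>S. sqrt (p k / n))"
      unfolding d(2) by (rule sum_mono) (rule E_d)
    \<comment> \<open>Cauchy-Schwarz, with the masses \<open>p k\<close> summing to 1.\<close>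
    also have "\<dots> \<le> sqrt (card S / n)"
    proof (rule real_le_rsqrt)
      have "(\<Sum>k\<in>S. sqrt (p k / n))\<^sup>2 \<le> (\<Sum>k\<in>S. (sqrt (p k / n))\<^sup>2) * card S"
        by (rule sum_squared_le_sum_of_squares)
      also have "(\<Sum>k\<in>S. (sqrt (p k / n))\<^sup>2) = (\<Sum>k\<in>S. p k / n)"
        using p by (intro sum.cong refl) (simp add: less_imp_le)
      also have "\<dots> = 1 / n" by (simp add: sum_p flip: sum_divide_distrib)
      finally show "(\<Sum>k\<in>S. sqrt (p k / n))\<^sup>2 \<le> card S / n" by simp
    qed
    finally show ?thesis using D(1) by (simp add: mult_left_mono)
  qed
  finally show ?thesis using A by (simp add: D_def S_def)
qed

theorem theorem2p5:
  fixes \<mu> :: "'a::polish_space measure"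
    and M :: "'b measure"
    and X :: "nat \<Rightarrow> 'b \<Rightarrow> 'a"
    and C t :: real
    and n :: nat
  assumes "C > 0"
    and "\<mu> \<in> prob_measures"
    and "T1 C \<mu>"
    and "prob_space M"
    and "n \<ge> 1"
    and "prob_space.indep_vars M (\<lambda>_. borel) X {1..n}"
    and "\<forall>i\<in>{1..n}. distr M borel (X i) = \<mu>"
    and "t > 0"
  shows "measure M {\<omega> \<in> space M. W1 \<mu> (empirical_measure n (\<lambda>i. X i \<omega>)) \<ge> ennreal t}
           \<le> K_const C \<mu> t * exp (- (real n * t\<^sup>2 / (8 * C)))"
proof -
  interpret prob_space M by fact
  note C = \<open>C > 0\<close> and t = \<open>t > 0\<close> and n = \<open>n \<ge> 1\<close>
  have mu1: "\<mu> \<in> prob_measures1" using assms(3) by (simp add: T1_def)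
  have law: "\<And>i. i \<in> {1..n} \<Longrightarrow> distr M borel (X i) = \<mu>" using assms(7) by blast
  define F where "F \<omega> = min (empirical_cost \<mu> n (\<lambda>i. X i \<omega>)) t" for \<omega>
  note tail = empirical_cost_tail[OF C assms(3) n t assms(6) law, folded F_def]
  have F0: "0 \<le> F \<omega>" "F \<omega> \<le> t" for \<omega>
    using empirical_cost_nonneg[OF _ n, of \<mu>] assms(2) t by (auto simp: F_def prob_measures_def)
  have Fm[measurable]: "F \<in> borel_measurable M" using tail(1) by (simp add: F_def[abs_def])
  have iF: "integrable M F"
    by (rule integrable_const_bound[where B=t]) (use F0 in auto)
  define e where "e = expectation F"
  have e: "e \<le> t" using tail(2) by (simp add: e_def)
  define P where "P = measure M {\<omega> \<in> space M. W1 \<mu> (empirical_measure n (\<lambda>i. X i \<omega>)) \<ge> ennreal t}"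
  have "P \<le> prob {\<omega> \<in> space M. t \<le> F \<omega>}"
    unfolding P_def
  \<comment> \<open>Monotonicity asks for measurability of the larger event only, which is the one
    defined by \<open>F\<close>.\<close>
  proof (rule finite_measure_mono)
    show "{\<omega> \<in> space M. ennreal t \<le> W1 \<mu> (empirical_measure n (\<lambda>i. X i \<omega>))} \<subseteq> {\<omega> \<in> space M. t \<le> F \<omega>}"
    proof safe
      fix \<omega> assume "ennreal t \<le> W1 \<mu> (empirical_measure n (\<lambda>i. X i \<omega>))"
      also have "\<dots> \<le> ennreal (empirical_cost \<mu> n (\<lambda>i. X i \<omega>))"
        by (rule W1_empirical_le_empirical_cost[OF mu1 n])
      finally show "t \<le> F \<omega>" using t by (simp add: F_def ennreal_le_iff2)
    qed
  qed measurable
  also have "\<dots> \<le> exp (- (n * (t - e)\<^sup>2 / C))" using tail(3) by (simp add: e_def)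
  finally have P: "P \<le> exp (- (n * (t - e)\<^sup>2 / C))" .
  define Q where "Q = {\<nu> \<in> prob_measures. finite (Supp \<nu>) \<and> W1 \<mu> \<nu> \<le> ennreal (t / 4)}"
  have Q_ne: "Q \<noteq> {}"
    using exists_finite_support_W1_le[OF mu1, of "t / 4"] t unfolding Q_def by fastforce
  have "C * (n * t\<^sup>2 / (8 * C) - n * (t - e)\<^sup>2 / C) \<le> card (Supp \<nu>) * (diameter (Supp \<nu>))\<^sup>2" if "\<nu> \<in> Q" for \<nu>
  proof -
    from that have nu: "\<nu> \<in> prob_measures" and fin: "finite (Supp \<nu>)" and W: "W1 \<mu> \<nu> \<le> ennreal (t / 4)"
      by (auto simp: Q_def)
    define a where "a = diameter (Supp \<nu>) * sqrt (card (Supp \<nu>) / n)"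
    have a0: "0 \<le> a"
      using finite_imp_bounded[OF fin] by (simp add: a_def diameter_ge_0)
    \<comment> \<open>The infimum in \<open>W1\<close> is approached up to
      \<open>\<epsilon> / 2\<close>, which counts twice in the bound on the mean.\<close>
    have "e \<le> (t / 2 + a) + \<epsilon>" if "0 < \<epsilon>" for \<epsilon>
    proof -
      have "W1 \<mu> \<nu> < ennreal (t / 4 + \<epsilon> / 2)"
        using W that t by (auto intro: le_less_trans simp: ennreal_less_iff)
      then obtain \<pi> where pi: "\<pi> \<in> couplings \<mu> \<nu>"
        and less: "(\<integral>\<^sup>+ z. ennreal (dist (fst z) (snd z)) \<partial>\<pi>) < ennreal (t / 4 + \<epsilon> / 2)"
        unfolding W1_def INF_less_iff by blast
      have "e \<le> 2 * (t / 4 + \<epsilon> / 2) + a"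
        unfolding e_def a_def
        by (rule expectation_empirical_cost_le[OF mu1 n assms(6) law nu fin pi less_imp_le[OF less] _ iF])
           (use that t in \<open>auto simp: F_def\<close>)
      then show ?thesis by simp
    qed
    then have "e \<le> t / 2 + a" by (rule field_le_epsilon)
    then have "t / 2 \<le> (t - e) + a" by simp
    \<comment> \<open>Keeping \<open>a\<close> on the right makes both sides nonnegative, so
      squaring also covers the case \<open>a > t / 2\<close>. The constant 8 is 4 from this square
      times 2 from splitting the square of the sum.\<close>
    then have "(t / 2)\<^sup>2 \<le> ((t - e) + a)\<^sup>2" using t by (intro power_mono) auto
    also have "\<dots> \<le> 2 * (t - e)\<^sup>2 + 2 * a\<^sup>2"
      using zero_le_power2[of "t - e - a"] by (simp add: power2_eq_square algebra_simps)
    finally have "t\<^sup>2 / 8 - (t - e)\<^sup>2 \<le> a\<^sup>2" by (simp add: power_divide)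
    then have "n * (t\<^sup>2 / 8 - (t - e)\<^sup>2) \<le> n * a\<^sup>2" by (rule mult_left_mono) simp
    also have "n * a\<^sup>2 = card (Supp \<nu>) * (diameter (Supp \<nu>))\<^sup>2"
      using n by (simp add: a_def power_mult_distrib)
    also have "n * (t\<^sup>2 / 8 - (t - e)\<^sup>2) = C * (n * t\<^sup>2 / (8 * C) - n * (t - e)\<^sup>2 / C)"
      using C by (simp add: field_simps)
    finally show ?thesis .
  qed
  \<comment> \<open>The left-hand side does not involve \<open>\<nu>\<close>, so the bound passes to
    the infimum.\<close>
  then have "C * (n * t\<^sup>2 / (8 * C) - n * (t - e)\<^sup>2 / C) \<le>
      (INF \<nu>\<in>Q. real (card (Supp \<nu>)) * (diameter (Supp \<nu>))\<^sup>2)" (is "_ \<le> ?I")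
    using Q_ne by (intro cINF_greatest) auto
  then have "n * t\<^sup>2 / (8 * C) - n * (t - e)\<^sup>2 / C \<le> 1 / C * ?I"
    using C by (simp add: pos_le_divide_eq mult.commute)
  then have "exp (- (n * (t - e)\<^sup>2 / C)) \<le> exp (1 / C * ?I - n * t\<^sup>2 / (8 * C))"
    by simp
  also have "\<dots> = K_const C \<mu> t * exp (- (real n * t\<^sup>2 / (8 * C)))"
    unfolding K_const_def Q_def[symmetric] by (simp flip: exp_add)
  finally show ?thesis using P unfolding P_def by simp
qed

end
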